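(* There is no circulant weighing matrix of order $60$ and weight $36$; equivalently, there is no sequence $[a_0,\dots,a_{59}]$ with entries in $\{0,\pm1\}$, exactly $36$ nonzero entries, and $\sum_{i=0}^{59}a_ia_{i+s}=0$ for all $s=1,\dots,59$ (indices mod 60).
   Context: A weighing matrix of order $n$ and weight $w>0$ is an $n\times n$ matrix $W$ with entries in $\{0,\pm1\}$ such that $WW^T=wI$. A circulant matrix is one in which each row is the cyclic shift by one position to the right of the previous row. *)

theory Defs
  imports Main
begin

definition weighing_matrix :: "nat \<Rightarrow> nat \<Rightarrow> (nat \<Rightarrow> nat \<Rightarrow> int) \<Rightarrow> bool" where
  "weighing_matrix n w W \<longleftrightarrow> w > 0 \<and>
     (\<forall>i<n. \<forall>j<n. W i j \<in> {-1, 0, 1}) \<and>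
     (\<forall>i<n. \<forall>k<n. (\<Sum>j<n. W i j * W k j) = (if i = k then int w else 0))"

definition circulant :: "nat \<Rightarrow> (nat \<Rightarrow> nat \<Rightarrow> int) \<Rightarrow> bool" where
  "circulant n W \<longleftrightarrow> (\<forall>i. i + 1 < n \<longrightarrow> (\<forall>j<n. W (i + 1) ((j + 1) mod n) = W i j))"

end

theory Submission
  imports Defs
begin

text \<open>View a circulant weighing matrix of order 60 and weight 36 as an element \<open>X\<close> of \<open>\<int>[C\<^sub>4 \<times> C\<^sub>3 \<times> C\<^sub>5]\<close>
  with \<open>X X\<^sup>* = 36\<close>, and apply the characters of \<open>C\<^sub>4\<close> and \<open>C\<^sub>3\<close>. Since \<open>-1\<close> is a power of 2 and of 3
  modulo 5, \<open>v v\<^sup>* \<equiv> 0\<close> forces \<open>v \<equiv> 0\<close> in \<open>\<bbbF>\<^sub>2[C\<^sub>5]\<close> and \<open>\<bbbF>\<^sub>3[C\<^sub>5]\<close>; applied over \<open>\<int>\<close>, \<open>\<int>[\<i>]\<close> and \<open>\<int>[\<omega>]\<close> this shows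
  that the image of \<open>X\<close> in \<open>\<int>[C\<^sub>2 \<times> C\<^sub>5]\<close> is \<open>\<plusminus>6g\<close> and that its image in \<open>\<int>[\<omega>][C\<^sub>2 \<times> C\<^sub>5]\<close> is 3 times an
  element \<open>e\<close> with \<open>e e\<^sup>* = 4\<close>. The elements of norm 4 in \<open>\<int>[\<omega>][C\<^sub>5]\<close> are \<open>2ug\<close> and the generalized weighing
  vectors with four unit entries. The first possibility contradicts the image \<open>D\<close> of \<open>X\<close> in \<open>\<int>[\<i>][C\<^sub>1\<^sub>5]\<close>, which
  would be divisible by \<open>1 + \<i>\<close>. In the second one the parities of \<open>D\<close> form one of two patterns, and the
  image of \<open>D/2\<close> in \<open>\<int>[\<i>][C\<^sub>5]\<close> has norm 9, hence is a unit times \<open>3g\<close> or a conjugate of \<open>2 + \<surd>-5\<close>; this leaves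
  finitely many candidates for \<open>D\<close>, excluded mostly modulo 4 by evaluation inside the logic.\<close>

section \<open>Correlations of arrays over \<open>C\<^sub>5 \<times> C\<^sub>3\<close>\<close>

text \<open>The coefficient of \<open>x* y\<close> at the element \<open>(p, i)\<close> of C5 x C3
  in the integral group ring, where the star inverts group elements.\<close>

definition corr :: "(nat \<Rightarrow> nat \<Rightarrow> int) \<Rightarrow> (nat \<Rightarrow> nat \<Rightarrow> int) \<Rightarrow> nat \<Rightarrow> nat \<Rightarrow> int" where
  "corr x y p i = (\<Sum>f<5. \<Sum>j<3. x f j * y ((f + p) mod 5) ((j + i) mod 3))"

definition row_sum :: "(nat \<Rightarrow> nat \<Rightarrow> int) \<Rightarrow> nat \<Rightarrow> int" where
  "row_sum x f = (\<Sum>j<3. x f j)"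

definition delta :: "int \<Rightarrow> nat \<Rightarrow> nat \<Rightarrow> int" where
  "delta c p i = (if p = 0 \<and> i = 0 then c else 0)"

lemma all_less5: "(\<forall>f<5. Q f) \<longleftrightarrow> Q 0 \<and> Q 1 \<and> Q 2 \<and> Q 3 \<and> Q (4::nat)"
  by (auto simp: less_Suc_eq numeral_eq_Suc)

lemma sum_less5: "(\<Sum>f<5. g f) = g 0 + g 1 + g 2 + g 3 + g (4::nat)" for g :: "nat \<Rightarrow> 'a::comm_monoid_add"
  by (simp add: numeral_eq_Suc add.assoc)

lemma sum_less3: "(\<Sum>f<3. g f) = g 0 + g 1 + g (2::nat)" for g :: "nat \<Rightarrow> 'a::comm_monoid_add"
  by (simp add: numeral_eq_Suc add.assoc)

lemma sum_rotate: "(\<Sum>j<n. g ((j + k) mod n)) = (\<Sum>j<n. g j)" for g :: "nat \<Rightarrow> 'a::comm_monoid_add"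
proof (cases "n = 0")
  case False
  have "inj_on (\<lambda>j. (j + k) mod n) {..<n}"
  proof (rule inj_onI)
    fix x y assume "x \<in> {..<n}" "y \<in> {..<n}" "(x + k) mod n = (y + k) mod n"
    then obtain q r where "x + k + n * q = y + k + n * r" unfolding nat_mod_eq_iff by blast
    then have "x mod n = y mod n" unfolding nat_mod_eq_iff by (intro exI[of _ q] exI[of _ r]) simp
    with \<open>x \<in> {..<n}\<close> \<open>y \<in> {..<n}\<close> show "x = y" by simp
  qed
  moreover have "(\<lambda>j. (j + k) mod n) ` {..<n} \<subseteq> {..<n}" using False by auto
  ultimately have "bij_betw (\<lambda>j. (j + k) mod n) {..<n} {..<n}"
    by (simp add: bij_betw_def endo_inj_surj)
  then show ?thesis by (rule sum.reindex_bij_betw)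
qed simp

text \<open>Let q be 2 or 3. Since q^2 = -1 modulo 5, Frobenius gives \<open>v* = v^(q^2)\<close>
  over F_q. So \<open>v v* = 0\<close> makes v nilpotent, and F_q[C5] is reduced because q does not
  divide 5. Shifts 3 and 4 repeat shifts 2 and 1.\<close>

lemma cyclic5_residues:
  "\<forall>q\<in>set [2, 3 :: int]. \<forall>a\<in>set [0,1,2]. \<forall>b\<in>set [0,1,2]. \<forall>c\<in>set [0,1,2]. \<forall>d\<in>set [0,1,2]. \<forall>e\<in>set [0,1,2].
     \<not> (q dvd a * a + b * b + c * c + d * d + e * e \<and> q dvd a * b + b * c + c * d + d * e + e * a \<and>
       q dvd a * c + b * d + c * e + d * a + e * b)
     \<or> q dvd a \<and> q dvd b \<and> q dvd c \<and> q dvd d \<and> q dvd e"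
  by code_simp

lemma cyclic5_dvd:
  fixes v :: "nat \<Rightarrow> int"
  assumes q: "q = 2 \<or> q = 3" and v: "\<And>p. p < 5 \<Longrightarrow> q dvd (\<Sum>f<5. v f * v ((f + p) mod 5))" and "f < 5"
  shows "q dvd v f"
proof -
  have m: "v 0 mod q \<in> {0,1,2}" "v 1 mod q \<in> {0,1,2}" "v 2 mod q \<in> {0,1,2}" "v 3 mod q \<in> {0,1,2}" "v 4 mod q \<in> {0,1,2}"
    using q by auto
  define w where "w f = v f mod q" for f
  have w: "w 0 \<in> {0,1,2}" "w 1 \<in> {0,1,2}" "w 2 \<in> {0,1,2}" "w 3 \<in> {0,1,2}" "w 4 \<in> {0,1,2}"
    using m by (auto simp: w_def)
  have "(\<Sum>f<5. w f * w ((f + p) mod 5)) mod q = (\<Sum>f<5. v f * v ((f + p) mod 5)) mod q" for p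
  proof -
    have "(\<Sum>f<5. (w f * w ((f + p) mod 5)) mod q) = (\<Sum>f<5. (v f * v ((f + p) mod 5)) mod q)"
      by (intro sum.cong refl) (simp add: w_def mod_mult_eq)
    then show ?thesis
      using mod_sum_eq[of "\<lambda>f. w f * w ((f + p) mod 5)" q "{..<5}"] mod_sum_eq[of "\<lambda>f. v f * v ((f + p) mod 5)" q "{..<5}"]
      by simp
  qed
  then have "q dvd (\<Sum>f<5. w f * w ((f + p) mod 5))" if "p < 5" for p
    using v[OF that] by (simp add: dvd_eq_mod_eq_0)
  from this[of 0] this[of 1] this[of 2]
  have "q dvd w 0 * w 0 + w 1 * w 1 + w 2 * w 2 + w 3 * w 3 + w 4 * w 4"
    "q dvd w 0 * w 1 + w 1 * w 2 + w 2 * w 3 + w 3 * w 4 + w 4 * w 0"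
    "q dvd w 0 * w 2 + w 1 * w 3 + w 2 * w 4 + w 3 * w 0 + w 4 * w 1"
    by (simp_all add: sum_less5 numeral_2_eq_2)
  moreover have "q \<in> set [2, 3]" and ww: "w 0 \<in> set [0,1,2]" "w 1 \<in> set [0,1,2]" "w 2 \<in> set [0,1,2]" "w 3 \<in> set [0,1,2]" "w 4 \<in> set [0,1,2]"
    using q w by simp_all
  ultimately have "q dvd w 0 \<and> q dvd w 1 \<and> q dvd w 2 \<and> q dvd w 3 \<and> q dvd w 4"
    using cyclic5_residues[THEN bspec, THEN bspec, THEN bspec, THEN bspec, THEN bspec, THEN bspec, OF \<open>q \<in> set [2, 3]\<close> ww] by blast
  then show ?thesis using \<open>f < 5\<close> all_less5[of "\<lambda>f. q dvd v f"]
    by (auto simp: w_def dvd_mod_iff)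
qed

text \<open>With \<open>z = x + \<i> y\<close> this is the step \<open>z = (1 + \<i>) z'\<close>: halving \<open>Re + Im\<close> of the
  autocorrelation of \<open>z\<close> leaves the autocorrelation of \<open>y\<close> modulo 2.\<close>

lemma gaussian_parity:
  fixes x y :: "'a \<Rightarrow> int"
  assumes "\<And>k. k \<in> S \<Longrightarrow> even (x k - y k) \<and> even (x (g k) - y (g k))"
    and "4 dvd (\<Sum>k\<in>S. x k * x (g k)) + (\<Sum>k\<in>S. y k * y (g k))"
    and "(\<Sum>k\<in>S. x k * y (g k)) = (\<Sum>k\<in>S. y k * x (g k))"
  shows "even (\<Sum>k\<in>S. y k * y (g k))"
proof -
  have "4 dvd x k * x (g k) + y k * y (g k) + y k * x (g k) - x k * y (g k) - 2 * (y k * y (g k))" if k: "k \<in> S" for k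
  proof -
    obtain a where "x k - y k = 2 * a" using assms(1)[OF k] by (meson dvdE)
    moreover obtain b where "x (g k) - y (g k) = 2 * b" using assms(1)[OF k] by (meson dvdE)
    ultimately have "x k = y k + 2 * a" "x (g k) = y (g k) + 2 * b" by auto
    then have "x k * x (g k) + y k * y (g k) + y k * x (g k) - x k * y (g k) - 2 * (y k * y (g k)) = 4 * (y k * b + a * b)"
      by (simp add: algebra_simps)
    then show ?thesis by simp
  qed
  then have "4 dvd (\<Sum>k\<in>S. x k * x (g k) + y k * y (g k) + y k * x (g k) - x k * y (g k) - 2 * (y k * y (g k)))"
    by (intro dvd_sum) auto
  also have "(\<Sum>k\<in>S. x k * x (g k) + y k * y (g k) + y k * x (g k) - x k * y (g k) - 2 * (y k * y (g k)))
    = (\<Sum>k\<in>S. x k * x (g k)) + (\<Sum>k\<in>S. y k * y (g k)) + (\<Sum>k\<in>S. y k * x (g k)) - (\<Sum>k\<in>S. x k * y (g k)) - 2 * (\<Sum>k\<in>S. y k * y (g k))"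
    by (simp only: sum.distrib sum_subtractf sum_distrib_left)
  finally have "4 dvd ((\<Sum>k\<in>S. x k * x (g k)) + (\<Sum>k\<in>S. y k * y (g k))) - 2 * (\<Sum>k\<in>S. y k * y (g k))"
    using assms(3) by simp
  then have "4 dvd 2 * (\<Sum>k\<in>S. y k * y (g k))"
    using assms(2) dvd_diff by (metis (no_types, lifting) diff_diff_eq2 add_diff_cancel_left')
  then show ?thesis by presburger
qed

text \<open>Summing over C3 is the ring homomorphism from Z[C5 x C3] to Z[C5], hence respects
  correlations.\<close>

lemma corr_row_sum:
  "(\<Sum>i<3. corr x y p i) = (\<Sum>f<5. row_sum x f * row_sum y ((f + p) mod 5))"
proof -
  have "(\<Sum>i<3. x f j * y F ((j + i) mod 3)) = x f j * row_sum y F" for f j F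
    using sum_rotate[of "y F" j 3] by (simp add: row_sum_def sum_distrib_left[symmetric] add.commute)
  then have "(\<Sum>f<5. \<Sum>j<3. \<Sum>i<3. x f j * y ((f + p) mod 5) ((j + i) mod 3)) =
     (\<Sum>f<5. row_sum x f * row_sum y ((f + p) mod 5))"
    by (simp add: row_sum_def[of x] sum_distrib_right)
  moreover have "(\<Sum>i<3. corr x y p i) = (\<Sum>f<5. \<Sum>j<3. \<Sum>i<3. x f j * y ((f + p) mod 5) ((j + i) mod 3))"
    unfolding corr_def by (subst sum.swap, rule sum.cong[OF refl], subst sum.swap, rule refl)
  ultimately show ?thesis by simp
qed

lemma corr_shift:
  "corr (\<lambda>f j. x ((f + m) mod 5) ((j + k) mod 3)) (\<lambda>f j. y ((f + m) mod 5) ((j + k) mod 3)) p i = corr x y p i"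
proof -
  have 1: "(((f + p) mod 5 + m) mod 5) = ((f + m) mod 5 + p) mod 5" for f
    by (simp add: mod_simps ac_simps)
  have 2: "(((j + i) mod 3 + k) mod 3) = ((j + k) mod 3 + i) mod 3" for j
    by (simp add: mod_simps ac_simps)
  show ?thesis unfolding corr_def 1 2
    using sum_rotate[of "\<lambda>f. \<Sum>j<3. x f ((j + k) mod 3) * y ((f + p) mod 5) (((j + k) mod 3 + i) mod 3)" m 5]
      sum_rotate[of "\<lambda>j. x f j * y ((f + p) mod 5) ((j + i) mod 3)" k 3 for f] by simp
qed

lemma corr_bilinear:
  "corr (\<lambda>f j. x f j + x' f j) y p i = corr x y p i + corr x' y p i"
  "corr (\<lambda>f j. x f j - x' f j) y p i = corr x y p i - corr x' y p i"
  "corr x (\<lambda>f j. y f j + y' f j) p i = corr x y p i + corr x y' p i"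
  "corr x (\<lambda>f j. y f j - y' f j) p i = corr x y p i - corr x y' p i"
  by (simp_all add: corr_def sum.distrib sum_subtractf algebra_simps)

lemma row_sum_dvd3:
  assumes "\<And>p i. p < 5 \<Longrightarrow> i < 3 \<Longrightarrow> corr x x p i = delta 36 p i" and "f < 5"
  shows "3 dvd row_sum x f"
proof (rule cyclic5_dvd[OF _ _ \<open>f < 5\<close>])
  fix p :: nat assume "p < 5"
  then have "(\<Sum>i<3. corr x x p i) = (\<Sum>i<3. delta 36 p i)" by (intro sum.cong) (auto simp: assms(1))
  also have "3 dvd \<dots>" by (intro dvd_sum) (auto simp: delta_def)
  finally show "3 dvd (\<Sum>f<5. row_sum x f * row_sum x ((f + p) mod 5))" by (simp add: corr_row_sum)
qed simp

text \<open>Modulo the prime over 3, the Eisenstein sum of a row divided by \<open>1 - \<omega>\<close> is, up to a unit, the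
  difference of two row entries.\<close>

lemma row_cong3:
  assumes c: "\<And>p i. p < 5 \<Longrightarrow> i < 3 \<Longrightarrow> corr x x p i = delta 36 p i" and "f < 5"
  shows "3 dvd x f 0 - x f 2" "3 dvd x f 1 - x f 2"
proof -
  have r: "3 dvd row_sum x f" if "f < 5" for f using row_sum_dvd3[of x, OF c that] .
  have "3 dvd x f 1 - x f 2"
  proof (rule cyclic5_dvd[where v = "\<lambda>f. x f 1 - x f 2", OF _ _ \<open>f < 5\<close>])
    fix p :: nat assume p: "p < 5"
    \<comment> \<open>Both row sums vanish modulo 3, so eliminating the first entries turns the
      inner product of the two rows into minus the product of their differences, modulo 3.\<close>
    have "3 dvd (\<Sum>j<3. x f j * x ((f + p) mod 5) j) + (x f 1 - x f 2) * (x ((f + p) mod 5) 1 - x ((f + p) mod 5) 2)"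
      if f: "f < 5" for f
    proof -
      obtain a where a: "row_sum x f = 3 * a" using r[OF f] by (auto elim: dvdE)
      have "(f + p) mod 5 < 5" by simp
      from r[OF this] obtain b where b: "row_sum x ((f + p) mod 5) = 3 * b" by (auto elim: dvdE)
      define F where "F = (f + p) mod 5"
      have x0: "x f 0 = 3 * a - x f 1 - x f 2" "x F 0 = 3 * b - x F 1 - x F 2"
        using a b unfolding row_sum_def sum_less3 F_def by linarith+
      have "(\<Sum>j<3. x f j * x F j) + (x f 1 - x f 2) * (x F 1 - x F 2)
        = 3 * (3 * a * b - a * (x F 1 + x F 2) - b * (x f 1 + x f 2) + x f 1 * x F 1 + x f 2 * x F 2)"
        unfolding sum_less3 x0 by (simp add: algebra_simps)
      then show ?thesis unfolding F_def by simp
    qed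
    then have "3 dvd (\<Sum>f<5. (\<Sum>j<3. x f j * x ((f + p) mod 5) j) + (x f 1 - x f 2) * (x ((f + p) mod 5) 1 - x ((f + p) mod 5) 2))"
      by (intro dvd_sum) auto
    moreover have "(\<Sum>f<5. \<Sum>j<3. x f j * x ((f + p) mod 5) j) = corr x x p 0"
      by (simp add: corr_def)
    ultimately have "3 dvd delta 36 p 0 + (\<Sum>f<5. (x f 1 - x f 2) * (x ((f + p) mod 5) 1 - x ((f + p) mod 5) 2))"
      using c[OF p, of 0] by (simp add: sum.distrib)
    moreover have "3 dvd delta 36 p 0" by (simp add: delta_def)
    ultimately show "3 dvd (\<Sum>f<5. (x f 1 - x f 2) * (x ((f + p) mod 5) 1 - x ((f + p) mod 5) 2))"
      by (simp add: dvd_add_right_iff)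
  qed simp
  then show "3 dvd x f 1 - x f 2" .
  with r[OF \<open>f < 5\<close>] show "3 dvd x f 0 - x f 2"
    unfolding row_sum_def sum_less3 by presburger
qed

text \<open>Because 1 + \<omega> + \<omega>^2 = 0, row f maps to 3 (a f + b f \<omega>). Dividing
  the norm 36 by 9 leaves norm 4; the two conclusions are its two coordinates.\<close>

lemma eisenstein_corr:
  assumes c: "\<And>p i. p < 5 \<Longrightarrow> i < 3 \<Longrightarrow> corr x x p i = delta 36 p i"
    and ab: "\<And>f. f < 5 \<Longrightarrow> x f 0 = x f 2 + 3 * a f" "\<And>f. f < 5 \<Longrightarrow> x f 1 = x f 2 + 3 * b f"
    and p: "p < 5"
  shows "(\<Sum>f<5. a f * a ((f + p) mod 5)) + (\<Sum>f<5. b f * b ((f + p) mod 5)) - (\<Sum>f<5. a f * b ((f + p) mod 5)) = delta 4 p 0"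
    and "(\<Sum>f<5. b f * a ((f + p) mod 5)) = (\<Sum>f<5. a f * b ((f + p) mod 5))"
proof -
  have m: "(f + p) mod 5 < 5" for f by simp
  \<comment> \<open>Subtracting c1 (1 + \<omega> + \<omega>^2) from c0 + c1 \<omega> + c2 \<omega>^2
    leaves the coordinates c0 - c1 and c2 - c1 with respect to 1 and \<omega>^2.\<close>
  have k: "(\<Sum>j<3. g j * h ((j + 0) mod 3)) - (\<Sum>j<3. g j * h ((j + 1) mod 3)) = 9 * (u * u' + v * v' - u * v')"
    "(\<Sum>j<3. g j * h ((j + 2) mod 3)) - (\<Sum>j<3. g j * h ((j + 1) mod 3)) = 9 * (v * u' - u * v')"
    if "g 0 = g 2 + 3 * u" "g 1 = g 2 + 3 * v" "h 0 = h 2 + 3 * u'" "h 1 = h 2 + 3 * v'"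
    for g h :: "nat \<Rightarrow> int" and u v u' v'
    by (simp_all add: sum_less3 that[unfolded numeral_2_eq_2 One_nat_def] numeral_2_eq_2 algebra_simps)
  have "(\<Sum>f<5. (\<Sum>j<3. x f j * x ((f + p) mod 5) ((j + 0) mod 3)) - (\<Sum>j<3. x f j * x ((f + p) mod 5) ((j + 1) mod 3)))
      = (\<Sum>f<5. 9 * (a f * a ((f + p) mod 5) + b f * b ((f + p) mod 5) - a f * b ((f + p) mod 5)))"
    by (intro sum.cong refl k(1) ab m) auto
  then have "corr x x p 0 - corr x x p 1 = (\<Sum>f<5. 9 * (a f * a ((f + p) mod 5) + b f * b ((f + p) mod 5) - a f * b ((f + p) mod 5)))"
    unfolding corr_def by (simp only: sum_subtractf)
  then show "(\<Sum>f<5. a f * a ((f + p) mod 5)) + (\<Sum>f<5. b f * b ((f + p) mod 5)) - (\<Sum>f<5. a f * b ((f + p) mod 5)) = delta 4 p 0"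
    using c[OF p, of 0] c[OF p, of 1] by (simp add: sum_distrib_left[symmetric] sum.distrib sum_subtractf delta_def split: if_splits)
  have "(\<Sum>f<5. (\<Sum>j<3. x f j * x ((f + p) mod 5) ((j + 2) mod 3)) - (\<Sum>j<3. x f j * x ((f + p) mod 5) ((j + 1) mod 3)))
      = (\<Sum>f<5. 9 * (b f * a ((f + p) mod 5) - a f * b ((f + p) mod 5)))"
    by (intro sum.cong refl k(2) ab m) auto
  then have "corr x x p 2 - corr x x p 1 = (\<Sum>f<5. 9 * (b f * a ((f + p) mod 5) - a f * b ((f + p) mod 5)))"
    unfolding corr_def by (simp only: sum_subtractf)
  then show "(\<Sum>f<5. b f * a ((f + p) mod 5)) = (\<Sum>f<5. a f * b ((f + p) mod 5))"
    using c[OF p, of 2] c[OF p, of 1] by (simp add: sum_distrib_left[symmetric] sum_subtractf delta_def split: if_splits)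
qed

section \<open>Images under the characters of \<open>C\<^sub>4\<close>\<close>

text \<open>A single nonzero multiple of 6 already exhausts the sum of squares.\<close>

lemma one_six:
  fixes v w :: "nat \<Rightarrow> int"
  assumes v: "\<And>f. f < 5 \<Longrightarrow> 6 dvd v f" and w: "\<And>f. f < 5 \<Longrightarrow> 6 dvd w f"
    and s: "(\<Sum>f<5. v f * v f) + (\<Sum>f<5. w f * w f) = 36"
  obtains l where "l < 5" "\<And>f. f < 5 \<Longrightarrow> f \<noteq> l \<Longrightarrow> v f = 0 \<and> w f = 0"
    "\<bar>v l\<bar> = 6 \<and> w l = 0 \<or> v l = 0 \<and> \<bar>w l\<bar> = 6"
proof -
  define h where "h f = v f * v f + w f * w f" for f
  have h36: "h f \<ge> 36" if "f < 5" "v f \<noteq> 0 \<or> w f \<noteq> 0" for f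
  proof -
    have sq: "x * x \<ge> 36" if "6 dvd x" "x \<noteq> 0" for x :: int
    proof -
      have "6 \<le> \<bar>x\<bar>" using that by (metis dvd_imp_le_int abs_numeral)
      then have "6 * 6 \<le> \<bar>x\<bar> * \<bar>x\<bar>" by (intro mult_mono) auto
      then show ?thesis by (simp add: abs_mult_self_eq)
    qed
    show ?thesis using sq[OF v] sq[OF w] that zero_le_square[of "v f"] zero_le_square[of "w f"]
      unfolding h_def by (smt (verit))
  qed
  have h0: "h f \<ge> 0" for f by (simp add: h_def)
  have sum: "(\<Sum>f<5. h f) = 36" using s by (simp add: h_def sum.distrib)
  obtain l where l: "l < 5" "h l \<noteq> 0" using sum by (metis lessThan_iff sum.neutral zero_neq_numeral)
  then have "v l \<noteq> 0 \<or> w l \<noteq> 0" by (auto simp: h_def)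
  with l h36 have "h l \<ge> 36" by blast
  have rest: "(\<Sum>f\<in>{..<5} - {l}. h f) = 36 - h l"
    using sum l by (simp add: sum_diff1)
  then have "(\<Sum>f\<in>{..<5} - {l}. h f) = 0" "h l = 36"
    using \<open>h l \<ge> 36\<close> sum_nonneg[of "{..<5} - {l}" h] h0 by auto
  then have z: "h f = 0" if "f < 5" "f \<noteq> l" for f
    using sum_nonneg_eq_0_iff[of "{..<5} - {l}" h] h0 that by auto
  obtain a b where ab: "v l = 6 * a" "w l = 6 * b" using v w l by (meson dvdE)
  then have "a * a + b * b = 1" using \<open>h l = 36\<close> by (simp add: h_def)
  moreover have "a * a = 0 \<or> a * a \<ge> 1" "b * b = 0 \<or> b * b \<ge> 1" "a * a \<ge> 0" "b * b \<ge> 0"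
    by (auto simp: int_one_le_iff_zero_less zero_less_mult_iff linorder_neq_iff)
  ultimately have "a * a = 1 \<and> b * b = 0 \<or> a * a = 0 \<and> b * b = 1" by linarith
  then have "\<bar>v l\<bar> = 6 \<and> w l = 0 \<or> v l = 0 \<and> \<bar>w l\<bar> = 6"
    using ab by (auto simp: zmult_eq_1_iff)
  moreover have "v f = 0 \<and> w f = 0" if "f < 5" "f \<noteq> l" for f
    using z[OF that] h36[OF that(1)] by force
  ultimately show ?thesis using l that by blast
qed

text \<open>The Fourier transform over \<open>\<int>/4\<close>: if \<open>A\<^sub>t\<close> are the four slices of the sequence, then
  \<open>s\<^sub>t = A\<^sub>t + A\<^bsub>t+2\<^esub>\<close> and \<open>d\<^sub>t = A\<^sub>t - A\<^bsub>t+2\<^esub>\<close> for \<open>t = 0, 1\<close>. The pair \<open>d\<^sub>0, d\<^sub>1\<close> stands for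
  the Gaussian-integer array \<open>d\<^sub>0 + \<i> d\<^sub>1\<close>.\<close>

locale cw_arrays =
  fixes s0 s1 d0 d1 :: "nat \<Rightarrow> nat \<Rightarrow> int"
  assumes s_corr: "\<And>p i. p < 5 \<Longrightarrow> i < 3 \<Longrightarrow> corr s0 s0 p i + corr s1 s1 p i = delta 36 p i"
    and s_cross: "\<And>p i. p < 5 \<Longrightarrow> i < 3 \<Longrightarrow> corr s0 s1 p i + corr s1 s0 p i = 0"
    and d_corr: "\<And>p i. p < 5 \<Longrightarrow> i < 3 \<Longrightarrow> corr d0 d0 p i + corr d1 d1 p i = delta 36 p i"
    and d_cross: "\<And>p i. p < 5 \<Longrightarrow> i < 3 \<Longrightarrow> corr d0 d1 p i = corr d1 d0 p i"
    and entries0: "\<And>f j. f < 5 \<Longrightarrow> j < 3 \<Longrightarrow> even (s0 f j - d0 f j) \<and> \<bar>s0 f j\<bar> + \<bar>d0 f j\<bar> \<le> 2"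
    and entries1: "\<And>f j. f < 5 \<Longrightarrow> j < 3 \<Longrightarrow> even (s1 f j - d1 f j) \<and> \<bar>s1 f j\<bar> + \<bar>d1 f j\<bar> \<le> 2"
begin

lemma swap: "cw_arrays s1 s0 d1 d0"
  using s_corr s_cross d_corr d_cross entries0 entries1 by unfold_locales (auto simp: add.commute)

text \<open>The arrays \<open>s0 + s1\<close> and \<open>s0 - s1\<close> are the images under the
  trivial and the quadratic character of C4.\<close>

lemma plus_corr:
  assumes "p < 5" "i < 3"
  shows "corr (\<lambda>f j. s0 f j + s1 f j) (\<lambda>f j. s0 f j + s1 f j) p i = delta 36 p i"
    and "corr (\<lambda>f j. s0 f j - s1 f j) (\<lambda>f j. s0 f j - s1 f j) p i = delta 36 p i"
  using s_corr[OF assms] s_cross[OF assms] by (simp_all add: corr_bilinear)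

text \<open>The row sums of \<open>d0\<close> and \<open>d1\<close> form an element of norm 36 in
  Z[i][C5]. Reduction modulo 2 extracts one factor 1 + i and \<open>gaussian_parity\<close> a
  second, so both are even; those of \<open>s0\<close> and \<open>s1\<close> have the same
  parities.\<close>

lemma even_row_sum:
  assumes "f < 5"
  shows "even (row_sum s0 f)" "even (row_sum s1 f)"
proof -
  have sc: "(\<Sum>i<3. corr d0 d0 p i) + (\<Sum>i<3. corr d1 d1 p i) = delta 36 p 0" if "p < 5" for p
    using that d_corr by (simp add: sum.distrib[symmetric]) (simp add: sum_less3 delta_def)
  define u v where "u = row_sum d0" and "v = row_sum d1"
  have uv: "(\<Sum>f<5. u f * u ((f + p) mod 5)) + (\<Sum>f<5. v f * v ((f + p) mod 5)) = delta 36 p 0" if "p < 5" for p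
    using sc[OF that] by (simp add: corr_row_sum u_def v_def)
  have cross: "(\<Sum>f<5. u f * v ((f + p) mod 5)) = (\<Sum>f<5. v f * u ((f + p) mod 5))" if "p < 5" for p
    unfolding u_def v_def corr_row_sum[symmetric] using d_cross that by (intro sum.cong) auto
  have even_uv: "even (u f + v f)" if "f < 5" for f
  proof (rule cyclic5_dvd[where v = "\<lambda>f. u f + v f" and q = 2, OF _ _ that])
    fix p :: nat assume p: "p < 5"
    have "(\<Sum>f<5. (u f + v f) * (u ((f + p) mod 5) + v ((f + p) mod 5))) = delta 36 p 0 + 2 * (\<Sum>f<5. u f * v ((f + p) mod 5))"
      using uv[OF p] cross[OF p] by (simp add: sum.distrib algebra_simps)
    also have "even \<dots>" by (simp add: delta_def)
    finally show "even (\<Sum>f<5. (u f + v f) * (u ((f + p) mod 5) + v ((f + p) mod 5)))" .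
  qed simp
  have ev: "even (v f)" if "f < 5" for f
  proof (rule cyclic5_dvd[OF _ _ that])
    fix p :: nat assume p: "p < 5"
    show "even (\<Sum>f<5. v f * v ((f + p) mod 5))"
    proof (rule gaussian_parity[where x = u])
      show "even (u f - v f) \<and> even (u ((f + p) mod 5) - v ((f + p) mod 5))" if "f \<in> {..<5}" for f
        using even_uv[of f] even_uv[of "(f + p) mod 5"] that by auto
      show "4 dvd (\<Sum>f<5. u f * u ((f + p) mod 5)) + (\<Sum>f<5. v f * v ((f + p) mod 5))"
        unfolding uv[OF p] by (simp add: delta_def)
    qed (rule cross[OF p])
  qed simp
  with even_uv have eu: "even (u f)" if "f < 5" for f using that by (metis dvd_add_left_iff)
  have "even (row_sum s0 f - u f)" "even (row_sum s1 f - v f)"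
    using entries0[OF assms] entries1[OF assms]
    unfolding u_def v_def row_sum_def sum_subtractf[symmetric] by (auto intro!: dvd_sum)
  with ev eu assms show "even (row_sum s0 f)" "even (row_sum s1 f)" by auto
qed

lemma row_sum_dvd6:
  assumes "f < 5"
  shows "6 dvd row_sum s0 f" "6 dvd row_sum s1 f"
proof -
  have "3 dvd row_sum s0 f + row_sum s1 f" "3 dvd row_sum s0 f - row_sum s1 f"
    using row_sum_dvd3[OF plus_corr(1) assms] row_sum_dvd3[OF plus_corr(2) assms]
    by (simp_all add: row_sum_def sum.distrib sum_subtractf)
  with even_row_sum[OF assms] show "6 dvd row_sum s0 f" "6 dvd row_sum s1 f" by presburger+
qed

text \<open>These row sums are the coefficients of the image in Z[C2 x C5], which is therefore 6 or
  -6 times a group element.\<close>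

lemma special_row:
  obtains l where "l < 5" "\<And>f. f < 5 \<Longrightarrow> f \<noteq> l \<Longrightarrow> row_sum s0 f = 0 \<and> row_sum s1 f = 0"
    "\<bar>row_sum s0 l\<bar> = 6 \<and> row_sum s1 l = 0 \<or> row_sum s0 l = 0 \<and> \<bar>row_sum s1 l\<bar> = 6"
proof (rule one_six[of "row_sum s0" "row_sum s1"])
  have "(\<Sum>f<5. row_sum s0 f * row_sum s0 ((f + 0) mod 5)) + (\<Sum>f<5. row_sum s1 f * row_sum s1 ((f + 0) mod 5)) = 36"
    unfolding corr_row_sum[symmetric] sum.distrib[symmetric] by (simp add: s_corr sum_less3 delta_def)
  then show "(\<Sum>f<5. row_sum s0 f * row_sum s0 f) + (\<Sum>f<5. row_sum s1 f * row_sum s1 f) = 36"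
    by simp
qed (use row_sum_dvd6 in auto)

lemma row_cong:
  assumes "f < 5"
  shows "3 dvd s0 f 0 - s0 f 2" "3 dvd s0 f 1 - s0 f 2" "3 dvd s1 f 0 - s1 f 2" "3 dvd s1 f 1 - s1 f 2"
  using row_cong3[OF plus_corr(1) assms] row_cong3[OF plus_corr(2) assms] by presburger+

end

text \<open>Zero and the six units of Z[\<omega>], in coordinates with respect to 1 and
  \<omega>.\<close>

definition unit_pairs :: "(int \<times> int) set" where
  "unit_pairs = {(0,0),(1,0),(-1,0),(0,1),(0,-1),(1,1),(-1,-1)}"

text \<open>Congruent entries between -2 and 2 differ by 0 or 3, so a and b lie in {-1, 0, 1}. The
  row sum is 3 (x 2 + a + b): sum 0 rules out opposite nonzero a and b, and sum 6 or -6 forces three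
  equal entries.\<close>

lemma row_shape:
  fixes x :: "nat \<Rightarrow> int"
  assumes "\<bar>x 0\<bar> \<le> 2" "\<bar>x 1\<bar> \<le> 2" "\<bar>x 2\<bar> \<le> 2" "3 dvd x 0 - x 2" "3 dvd x 1 - x 2"
    and s: "x 0 + x 1 + x 2 = 0 \<or> \<bar>x 0 + x 1 + x 2\<bar> = 6"
  obtains a b where "x 0 = x 2 + 3 * a" "x 1 = x 2 + 3 * b" "(a, b) \<in> unit_pairs"
    "x 0 + x 1 + x 2 = 0 \<Longrightarrow> x 2 = - a - b" "x 0 + x 1 + x 2 \<noteq> 0 \<Longrightarrow> a = 0 \<and> b = 0 \<and> \<bar>x 2\<bar> = 2"
proof -
  obtain a where a: "x 0 - x 2 = 3 * a" using assms(4) by (auto elim: dvdE)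
  obtain b where b: "x 1 - x 2 = 3 * b" using assms(5) by (auto elim: dvdE)
  have "a \<in> {-1,0,1}" "b \<in> {-1,0,1}" using a b assms(1-3) by auto
  then have "(a, b) \<in> unit_pairs \<and> (x 0 + x 1 + x 2 = 0 \<longrightarrow> x 2 = - a - b) \<and>
      (x 0 + x 1 + x 2 \<noteq> 0 \<longrightarrow> a = 0 \<and> b = 0 \<and> \<bar>x 2\<bar> = 2)"
    using a b assms(1-3) s unfolding unit_pairs_def by auto
  then show ?thesis using a b that[of a b] by auto
qed

section \<open>Finite searches\<close>

fun dot :: "int list \<Rightarrow> int list \<Rightarrow> int" where
  "dot (x # xs) (y # ys) = x * y + dot xs ys"
| "dot _ _ = 0"

text \<open>Depth-first searches for vectors of prescribed norm that test each vector at a leaf. No list of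
  vectors is built, and branching uses \<open>\<and>\<close> and \<open>\<or>\<close> only, because these (unlike \<open>if\<close>) are
  short-circuited by symbolic evaluation.\<close>

fun norm_search :: "('a list \<Rightarrow> bool) \<Rightarrow> ('a \<times> int) list \<Rightarrow> nat \<Rightarrow> int \<Rightarrow> 'a list \<Rightarrow> bool" where
  "norm_search Q L 0 k v \<longleftrightarrow> k \<noteq> 0 \<or> Q v"
| "norm_search Q L (Suc n) k v \<longleftrightarrow> list_all (\<lambda>(x, m). \<not> m \<le> k \<or> norm_search Q L n (k - m) (x # v)) L"

definition int_norms :: "(int \<times> int) list" where
  "int_norms = [(0,0),(1,1),(-1,1),(2,4),(-2,4),(3,9),(-3,9)]"

text \<open>The off-peak coefficients of the norm vanish; shifts 3 and 4 follow from 2 and 1 by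
  symmetry.\<close>

definition gauss_ok :: "int list \<Rightarrow> int list \<Rightarrow> bool" where
  "gauss_ok x y \<longleftrightarrow> list_all (\<lambda>p. dot x (rotate p x) + dot y (rotate p y) = 0 \<and> dot x (rotate p y) = dot y (rotate p x)) [1, 2]"

text \<open>Pairs of real and imaginary parts of the elements of norm 9 in \<open>\<int>[\<i>][C\<^sub>5]\<close>. Up to units and shifts
  they are 3 and the elements with the values \<open>2 \<plusminus> \<surd>-5\<close> at the nontrivial characters; \<open>[0, 1, -1, -1, 1]\<close>
  is a Gauss sum.\<close>

definition gauss_sols :: "(int list \<times> int list) list" where
  "gauss_sols = concat (map (\<lambda>l. concat (map (\<lambda>s.
      (rotate l [3*s,0,0,0,0], [0,0,0,0,0]) # ([0,0,0,0,0], rotate l [3*s,0,0,0,0]) #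
      concat (map (\<lambda>r. [(rotate l [s,-s,-s,-s,-s], rotate l [0,r,-r,-r,r]), (rotate l [0,r,-r,-r,r], rotate l [s,-s,-s,-s,-s])]) [1,-1])) [1,-1])) [0,1,2,3,4])"

definition gauss_good :: "int list \<Rightarrow> int list \<Rightarrow> bool" where
  "gauss_good x y \<longleftrightarrow> sum_list y \<noteq> 0 \<or> \<not> gauss_ok x y \<or> (x, y) \<in> set gauss_sols \<and> (y, x) \<in> set gauss_sols"

text \<open>The coefficient sums A and B satisfy A^2 + B^2 = 9, so one is 3 or -3 and the other 0.
  The search puts the nonzero one first, and the test of both orders in \<open>gauss_good\<close>
  covers the other case.\<close>

definition gauss_first :: "int list \<Rightarrow> bool" where
  "gauss_first x \<longleftrightarrow> sum_list x \<noteq> 3 \<and> sum_list x \<noteq> -3 \<or> norm_search (gauss_good x) int_norms 5 (9 - dot x x) []"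

text \<open>The sum of squares of the first vector has the parity of its sum 3 or -3, hence is
  odd.\<close>

lemma gauss_search: "list_all (\<lambda>n. norm_search gauss_first int_norms 5 n []) [1,3,5,7,9]"
  by code_simp

text \<open>Pairs \<open>(a, b)\<close> stand for the Eisenstein integers \<open>a + b\<omega>\<close>.\<close>

definition eis_norms :: "((int \<times> int) \<times> int) list" where
  "eis_norms = [((0,0),0),((1,0),1),((-1,0),1),((0,1),1),((0,-1),1),((1,1),1),((-1,-1),1),
     ((1,-1),3),((-1,1),3),((1,2),3),((-1,-2),3),((2,1),3),((-2,-1),3),
     ((2,0),4),((-2,0),4),((0,2),4),((0,-2),4),((2,2),4),((-2,-2),4)]"

definition eis_ok :: "int list \<Rightarrow> int list \<Rightarrow> bool" where
  "eis_ok a b \<longleftrightarrow> list_all (\<lambda>p. dot a (rotate p a) + dot b (rotate p b) = dot a (rotate p b) \<and>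
         dot b (rotate p a) = dot a (rotate p b)) [1,2]"

text \<open>With the unit u = a + b \<omega>, these are the rotations of
  [0, u, \<omega> u, \<omega> u, u] and [0, u, \<omega>^2 u, \<omega>^2 u, u].\<close>

definition eis_sols :: "(int \<times> int) list list" where
  "eis_sols = concat (map (\<lambda>m. concat (map (\<lambda>(a, b).
      [rotate m [(0,0),(a,b),(-b,a-b),(-b,a-b),(a,b)], rotate m [(0,0),(a,b),(b-a,-a),(b-a,-a),(a,b)]])
      [(1,0),(-1,0),(0,1),(0,-1),(1,1),(-1,-1)])) [0,1,2,3,4])"

definition even_pair :: "int \<times> int \<Rightarrow> bool" where
  "even_pair z \<longleftrightarrow> even (fst z) \<and> even (snd z)"

definition eis_good :: "(int \<times> int) list \<Rightarrow> bool" where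
  "eis_good z \<longleftrightarrow> \<not> eis_ok (map fst z) (map snd z) \<or> list_all even_pair z \<or> z \<in> set eis_sols"

lemma eis_search: "norm_search eis_good eis_norms 5 4 []"
  by code_simp

definition eis_cong :: "int \<times> int \<Rightarrow> int \<times> int \<Rightarrow> bool" where
  "eis_cong z w \<longleftrightarrow> even (fst z - fst w) \<and> even (snd z - snd w)"
definition eis_neg :: "int \<times> int \<Rightarrow> int \<times> int" where
  "eis_neg z = (- fst z, - snd z)"
definition eis_pair_good :: "(int \<times> int) list \<Rightarrow> (int \<times> int) list \<Rightarrow> bool" where
  "eis_pair_good z w \<longleftrightarrow> \<not> list_all2 eis_cong z w \<or> w = z \<or> w = map eis_neg z"

text \<open>Modulo 2 the position of the zero stays visible and each unit is determined up to sign;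
  the sign is common to all four entries. This will compare the images of \<open>s0 + s1\<close> and
  \<open>s0 - s1\<close>.\<close>

lemma eis_pairs: "list_all (\<lambda>z. list_all (eis_pair_good z) eis_sols) eis_sols"
  by code_simp

fun list_corr :: "int list list \<Rightarrow> int list list \<Rightarrow> nat \<Rightarrow> int" where
  "list_corr (x # xs) (y # ys) i = dot x (rotate i y) + list_corr xs ys i"
| "list_corr _ _ i = 0"

definition shifts :: "(nat \<times> nat) list" where
  "shifts = [(1,0),(1,1),(1,2),(2,0),(2,1),(2,2),(3,0),(3,1),(3,2),(4,0),(4,1),(4,2),(0,1),(0,2)]"

definition autocorr_odd :: "int list list \<Rightarrow> bool" where
  "autocorr_odd x \<longleftrightarrow> list_ex (\<lambda>(p, i). odd (list_corr x (rotate p x) i)) shifts"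

definition parity_rows :: "(int list \<times> int) list" where
  "parity_rows = [([0,0,0],0),([0,1,1],1),([1,0,1],1),([1,1,0],1)]"

text \<open>A necessary condition: if the other component is 2h, the off-peak autocorrelation of x
  is -4 times that of h.\<close>

definition mod4_ok :: "int list list \<Rightarrow> bool" where
  "mod4_ok x \<longleftrightarrow> list_all (\<lambda>(p, i). 4 dvd list_corr x (rotate p x) i) shifts"

text \<open>Modulo 2 the symmetry of the cross-correlation sees the odd component only through its
  mask, so one test serves all candidates with that mask.\<close>

definition sym2_ok :: "int list list \<Rightarrow> int list list \<Rightarrow> bool" where
  "sym2_ok x y \<longleftrightarrow> list_all (\<lambda>(p, i). even (list_corr x (rotate p y) i - list_corr y (rotate p x) i)) shifts"

definition full_ok :: "int list list \<Rightarrow> int list list \<Rightarrow> bool" where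
  "full_ok x y \<longleftrightarrow> list_all (\<lambda>(p, i). list_corr x (rotate p y) i = list_corr y (rotate p x) i \<and>
     list_corr x (rotate p x) i + 4 * list_corr y (rotate p y) i = 0) shifts"

text \<open>The parities of a row of \<open>s\<^sub>t\<close> or \<open>d\<^sub>t\<close> are determined by its Eisenstein integer modulo 2. The two
  masks are those of the non-even solutions in \<open>eis_sols\<close>, up to shifts in both coordinates.\<close>

definition parity_mask :: "int \<Rightarrow> int list list" where
  "parity_mask e = (if e = 1 then [[0,0,0],[0,1,1],[1,0,1],[1,0,1],[0,1,1]] else [[0,0,0],[0,1,1],[1,1,0],[1,1,0],[0,1,1]])"

definition row_weight :: "int list \<Rightarrow> int" where
  "row_weight r = sum_list (map abs r)"

fun row_search :: "('a list \<Rightarrow> bool) \<Rightarrow> ('a \<times> int) list list \<Rightarrow> int \<Rightarrow> 'a list \<Rightarrow> bool" where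
  "row_search Q [] k v \<longleftrightarrow> k \<noteq> 0 \<or> Q v"
| "row_search Q (L # Ls) k v \<longleftrightarrow> list_all (\<lambda>(x, m). \<not> m \<le> k \<or> row_search Q Ls (k - m) (x # v)) L"

text \<open>The component with odd entries is called \<open>x\<close>, the other one is \<open>2t\<close> with \<open>t\<close> ternary, and \<open>(X, Y)\<close> are
  the halves of their row sums. If row 0 of \<open>x\<close> has absolute sum \<open>2w\<close>, then \<open>4w + 8 + 4|t| = 36\<close>, so \<open>t\<close> has
  weight \<open>7 - w\<close>. The row of zeros must be part of the search: without it there are solutions.\<close>

definition tern_rows :: "int \<Rightarrow> (int list \<times> int) list" where
  "tern_rows s = map (\<lambda>r. (r, row_weight r)) (filter (\<lambda>r. sum_list r = s) (product_lists [[0,1,-1],[0,1,-1],[0,1,-1]]))"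

definition mask_rows :: "int list list \<Rightarrow> int \<Rightarrow> int list list" where
  "mask_rows es s = filter (\<lambda>r. sum_list r = 2 * s) (product_lists es)"

definition odd_cands :: "int \<Rightarrow> int list \<Rightarrow> int list list list" where
  "odd_cands e X = filter mod4_ok (product_lists (mask_rows [[0,2,-2],[0,2,-2],[0,2,-2]] (hd X) #
     map2 (\<lambda>r. mask_rows (map (\<lambda>u. if u = 1 then [1,-1] else [0]) r)) (tl (parity_mask e)) (tl X)))"

definition has_zero_row :: "int list list \<Rightarrow> bool" where
  "has_zero_row x \<longleftrightarrow> list_ex (\<lambda>r. r = [0,0,0]) x"

definition even_good :: "int \<Rightarrow> int list list list \<Rightarrow> int list list \<Rightarrow> bool" where
  "even_good e os t \<longleftrightarrow> \<not> sym2_ok (parity_mask e) t \<or>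
     list_all (\<lambda>x. \<not> (has_zero_row x \<or> has_zero_row t) \<or> \<not> full_ok x t) os"

text \<open>\<open>row_search\<close> conses the rows, so it visits them from the last to the
  first.\<close>

definition weight_good :: "int \<Rightarrow> int list \<Rightarrow> int \<Rightarrow> int list list list \<Rightarrow> bool" where
  "weight_good e Y w os \<longleftrightarrow> os = [] \<or> row_search (even_good e os) (rev (map tern_rows Y)) (7 - w) []"

definition cands_good :: "int \<Rightarrow> int list \<Rightarrow> int list list list \<Rightarrow> bool" where
  "cands_good e Y os \<longleftrightarrow> list_all (\<lambda>w. weight_good e Y w (filter (\<lambda>x. row_weight (hd x) = 2 * w) os)) [0,1,2,3]"

definition final_good :: "int \<Rightarrow> bool" where
  "final_good e \<longleftrightarrow> list_all (\<lambda>(X, Y). cands_good e Y (odd_cands e X)) gauss_sols"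

text \<open>Modulo 2 the entries satisfy \<open>x 2 = a + b\<close>, \<open>x 0 = x 2 + a\<close>
  and \<open>x 1 = x 2 + b\<close>.\<close>

definition parity_row :: "int \<times> int \<Rightarrow> int list" where
  "parity_row z = [snd z mod 2, fst z mod 2, (fst z + snd z) mod 2]"

text \<open>Modulo 2 the sign of u disappears, and a factor \<omega> rotates every row over C3. Up
  to translation only the two shapes of \<open>eis_sols\<close> remain.\<close>

lemma eis_sols_mask:
  "list_all (\<lambda>z. list_ex (\<lambda>m. list_ex (\<lambda>k. list_ex (\<lambda>e.
     map (rotate k) (rotate m (map parity_row z)) = parity_mask e) [1, 2]) [0, 1, 2]) [0, 1, 2, 3, 4]) eis_sols"
  by code_simp

text \<open>At a shift p taking one nonzero row to the other, only these two rows meet. Two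
  2-subsets of C3 share exactly one point for two of the three values of i, which gives an odd
  coefficient.\<close>

lemma two_odd_rows: "norm_search autocorr_odd parity_rows 5 2 []"
  by code_simp

lemma final_search1: "final_good 1"
  by code_simp

lemma final_search2: "final_good 2"
  by code_simp

section \<open>Eisenstein integers of norm 4 over \<open>C\<^sub>5\<close>\<close>

text \<open>Nonnegative norms ensure that the pruning never cuts off \<open>w\<close>; consing
  delivers it reversed at the leaf.\<close>

lemma norm_search_sound:
  assumes "norm_search Q L n k v" "length w = n" "\<And>x. x \<in> set w \<Longrightarrow> (x, N x) \<in> set L" "\<And>x. 0 \<le> N x"
    "sum_list (map N w) = k"
  shows "Q (rev w @ v)"
  using assms
proof (induction n arbitrary: k v w)
  case (Suc n)
  then obtain x u where w: "w = x # u" "length u = n" by (cases w) auto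
  have "0 \<le> sum_list (map N u)" using Suc.prems(4) by (intro sum_list_nonneg) auto
  then have "N x \<le> k" using Suc.prems(5) w by simp
  moreover have "(x, N x) \<in> set L" using Suc.prems(3) w by simp
  ultimately have "norm_search Q L n (k - N x) (x # v)"
    using Suc.prems(1) by (auto simp: list_all_iff)
  from Suc.IH[OF this w(2)] Suc.prems w show ?case by simp
qed simp

lemma row_search_sound:
  assumes "row_search Q Ls k v" "list_all2 (\<lambda>x L. (x, N x) \<in> set L) w Ls" "\<And>x. 0 \<le> N x" "sum_list (map N w) = k"
  shows "Q (rev w @ v)"
  using assms
proof (induction Ls arbitrary: k v w)
  case (Cons L Ls)
  then obtain x u where w: "w = x # u" "(x, N x) \<in> set L" "list_all2 (\<lambda>x L. (x, N x) \<in> set L) u Ls"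
    by (auto simp: list_all2_Cons2)
  have "0 \<le> sum_list (map N u)" using Cons.prems(3) by (intro sum_list_nonneg) auto
  then have "N x \<le> k" using Cons.prems(4) w by simp
  then have "row_search Q Ls (k - N x) (x # v)"
    using Cons.prems(1) w by (auto simp: list_all_iff)
  from Cons.IH[OF this w(3)] Cons.prems w show ?case by simp
qed simp

section \<open>Arrays as lists for the finite searches\<close>

definition vec :: "(nat \<Rightarrow> 'a) \<Rightarrow> 'a list" where
  "vec v = map v [0..<5]"

definition rows :: "(nat \<Rightarrow> nat \<Rightarrow> int) \<Rightarrow> int list list" where
  "rows x = map (\<lambda>f. map (x f) [0..<3]) [0..<5]"

lemma rotate_map_upt: "rotate p (map g [0..<n]) = map (\<lambda>f. g ((f + p) mod n)) [0..<n]"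
  by (rule nth_equalityI) (auto simp: nth_rotate add.commute)

lemma dot_map: "dot (map a xs) (map b xs) = (\<Sum>x\<leftarrow>xs. a x * b x)"
  by (induction xs) auto

lemma list_corr_map: "list_corr (map g xs) (map h xs) i = (\<Sum>x\<leftarrow>xs. dot (g x) (rotate i (h x)))"
  by (induction xs) auto

lemma dot_vec: "dot (vec a) (rotate p (vec b)) = (\<Sum>f<5. a f * b ((f + p) mod 5))"
  unfolding vec_def rotate_map_upt dot_map interv_sum_list_conv_sum_set_nat set_upt by (simp add: atLeast0LessThan)

lemma list_corr_rows: "list_corr (rows x) (rotate p (rows y)) i = corr x y p i"
  unfolding rows_def rotate_map_upt list_corr_map dot_map corr_def interv_sum_list_conv_sum_set_nat
  by (simp add: atLeast0LessThan)

lemma upt5: "[0..<5] = [0, 1, 2, 3, 4]" and upt3: "[0..<3] = [0, 1, 2]"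
  by (simp_all add: upt_rec)

lemma eis_norms_complete:
  "\<forall>a\<in>set [-2,-1,0,1,2]. \<forall>b\<in>set [-2,-1,0,1,2].
     \<not> a * a + b * b - a * b \<le> 4 \<or> ((a, b), a * a + b * b - a * b) \<in> set eis_norms"
  by code_simp

lemma eis_classify:
  assumes bd: "\<And>f. f < 5 \<Longrightarrow> \<bar>a f\<bar> \<le> 2 \<and> \<bar>b f\<bar> \<le> 2"
    and c: "\<And>p. p < 5 \<Longrightarrow> (\<Sum>f<5. a f * a ((f + p) mod 5)) + (\<Sum>f<5. b f * b ((f + p) mod 5)) - (\<Sum>f<5. a f * b ((f + p) mod 5)) = delta 4 p 0"
    "\<And>p. p < 5 \<Longrightarrow> (\<Sum>f<5. b f * a ((f + p) mod 5)) = (\<Sum>f<5. a f * b ((f + p) mod 5))"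
  shows "(\<forall>f<5. even (a f) \<and> even (b f)) \<or> vec (\<lambda>f. (a f, b f)) \<in> set eis_sols"
proof -
  define N where "N z = fst z * fst z + snd z * snd z - fst z * snd z" for z :: "int \<times> int"
  have N0: "0 \<le> N z" for z
  proof -
    have "0 \<le> (fst z - snd z)\<^sup>2 + fst z * fst z + snd z * snd z" by simp
    also have "\<dots> = 2 * N z" by (simp add: N_def power2_eq_square algebra_simps)
    finally show ?thesis by simp
  qed
  let ?z = "vec (\<lambda>f. (a f, b f))"
  have S: "(\<Sum>f<5. N (a f, b f)) = 4"
    using c(1)[of 0] by (simp add: N_def sum.distrib sum_subtractf delta_def)
  then have "sum_list (map N (rev ?z)) = 4"
    by (simp add: vec_def rev_map[symmetric] interv_sum_list_conv_sum_set_nat atLeast0LessThan o_def)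
  moreover have "(z, N z) \<in> set eis_norms" if z: "z \<in> set (rev ?z)" for z
  proof -
    obtain f where f: "f < 5" "z = (a f, b f)" using z by (auto simp: vec_def)
    have "N z \<le> 4" using member_le_sum[of f "{..<5}" "\<lambda>f. N (a f, b f)"] f N0 S by auto
    moreover have "a f \<in> set [-2,-1,0,1,2]" "b f \<in> set [-2,-1,0,1,2]" using bd[OF f(1)] by auto
    note bspec[OF bspec[OF eis_norms_complete this(1)] this(2)]
    ultimately show ?thesis unfolding f(2) N_def fst_conv snd_conv by blast
  qed
  moreover have "length (rev ?z) = 5" by (simp add: vec_def)
  ultimately have "eis_good ?z"
    using norm_search_sound[OF eis_search, of "rev ?z" N] N0 by simp
  moreover have "map fst ?z = vec a" "map snd ?z = vec b" by (simp_all add: vec_def)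
  moreover have "eis_ok (vec a) (vec b)"
    using c(1)[of 1] c(1)[of 2] c(2)[of 1] c(2)[of 2] unfolding eis_ok_def dot_vec by (simp add: dot_vec delta_def)
  ultimately have "list_all even_pair ?z \<or> ?z \<in> set eis_sols" by (simp add: eis_good_def)
  then show ?thesis by (auto simp: even_pair_def vec_def list_all_iff)
qed

section \<open>Rows as Eisenstein units\<close>

lemma unit_pairs_le: "(a, b) \<in> unit_pairs \<Longrightarrow> \<bar>a\<bar> \<le> 1 \<and> \<bar>b\<bar> \<le> 1"
  by (auto simp: unit_pairs_def)

text \<open>For a row with entries congruent modulo 3, the image in Z[\<omega>] is 3 times
  \<open>eis_a x f\<close> + \<open>eis_b x f\<close> \<omega>.\<close>

definition eis_a :: "(nat \<Rightarrow> nat \<Rightarrow> int) \<Rightarrow> nat \<Rightarrow> int" where "eis_a x f = (x f 0 - x f 2) div 3"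
definition eis_b :: "(nat \<Rightarrow> nat \<Rightarrow> int) \<Rightarrow> nat \<Rightarrow> int" where "eis_b x f = (x f 1 - x f 2) div 3"

definition unit_row :: "(nat \<Rightarrow> nat \<Rightarrow> int) \<Rightarrow> nat \<Rightarrow> bool" where
  "unit_row x f \<longleftrightarrow> x f 0 = x f 2 + 3 * eis_a x f \<and> x f 1 = x f 2 + 3 * eis_b x f \<and> (eis_a x f, eis_b x f) \<in> unit_pairs \<and>
     (row_sum x f = 0 \<longrightarrow> x f 2 = - eis_a x f - eis_b x f) \<and>
     (row_sum x f \<noteq> 0 \<longrightarrow> eis_a x f = 0 \<and> eis_b x f = 0 \<and> \<bar>x f 2\<bar> = 2)"

lemma unit_rowI:
  assumes "\<And>j. j < 3 \<Longrightarrow> \<bar>x f j\<bar> \<le> 2" "3 dvd x f 0 - x f 2" "3 dvd x f 1 - x f 2"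
    "row_sum x f = 0 \<or> \<bar>row_sum x f\<bar> = 6"
  shows "unit_row x f"
proof -
  have s: "row_sum x f = x f 0 + x f 1 + x f 2" by (simp add: row_sum_def sum_less3)
  have bd: "\<bar>x f 0\<bar> \<le> 2" "\<bar>x f 1\<bar> \<le> 2" "\<bar>x f 2\<bar> \<le> 2" using assms(1) by auto
  obtain a b where ab: "x f 0 = x f 2 + 3 * a" "x f 1 = x f 2 + 3 * b" "(a, b) \<in> unit_pairs"
    "row_sum x f = 0 \<Longrightarrow> x f 2 = - a - b" "row_sum x f \<noteq> 0 \<Longrightarrow> a = 0 \<and> b = 0 \<and> \<bar>x f 2\<bar> = 2"
    using row_shape[OF bd assms(2,3) assms(4)[unfolded s]] unfolding s by blast
  moreover have "eis_a x f = a" "eis_b x f = b" using ab by (simp_all add: eis_a_def eis_b_def)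
  ultimately show ?thesis by (auto simp: unit_row_def)
qed

lemma unit_row_parity:
  assumes "unit_row x f"
  shows "map (\<lambda>j. x f j mod 2) [0..<3] = parity_row (eis_a x f, eis_b x f)"
proof -
  have "even (x f 2 - (eis_a x f + eis_b x f))"
  proof (cases "row_sum x f = 0")
    case False
    then have "eis_a x f = 0" "eis_b x f = 0" "x f 2 = 2 \<or> x f 2 = - 2" using assms unfolding unit_row_def by linarith+
    then show ?thesis by auto
  qed (use assms in \<open>auto simp: unit_row_def\<close>)
  moreover have "x f 0 = x f 2 + 3 * eis_a x f" "x f 1 = x f 2 + 3 * eis_b x f" using assms unfolding unit_row_def by blast+
  ultimately have "x f 0 mod 2 = eis_b x f mod 2" "x f 1 mod 2 = eis_a x f mod 2" "x f 2 mod 2 = (eis_a x f + eis_b x f) mod 2"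
    by presburger+
  then show ?thesis by (simp add: upt3 parity_row_def)
qed

context cw_arrays
begin

lemma special_unit_rows:
  obtains l where "l < 5" "\<And>f. f < 5 \<Longrightarrow> f \<noteq> l \<Longrightarrow> row_sum s0 f = 0 \<and> row_sum s1 f = 0"
    "\<bar>row_sum s0 l\<bar> = 6 \<and> row_sum s1 l = 0 \<or> row_sum s0 l = 0 \<and> \<bar>row_sum s1 l\<bar> = 6"
    "\<And>f. f < 5 \<Longrightarrow> unit_row s0 f \<and> unit_row s1 f"
proof -
  obtain l where l: "l < 5" "\<And>f. f < 5 \<Longrightarrow> f \<noteq> l \<Longrightarrow> row_sum s0 f = 0 \<and> row_sum s1 f = 0"
    "\<bar>row_sum s0 l\<bar> = 6 \<and> row_sum s1 l = 0 \<or> row_sum s0 l = 0 \<and> \<bar>row_sum s1 l\<bar> = 6"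
    using special_row by blast
  have "unit_row s0 f \<and> unit_row s1 f" if f: "f < 5" for f
  proof -
    have "row_sum s0 f = 0 \<or> \<bar>row_sum s0 f\<bar> = 6" "row_sum s1 f = 0 \<or> \<bar>row_sum s1 f\<bar> = 6"
      using l f by (cases "f = l"; auto)+
    moreover have "\<bar>s0 f j\<bar> \<le> 2" "\<bar>s1 f j\<bar> \<le> 2" if "j < 3" for j
      using entries0[OF f that] entries1[OF f that] by linarith+
    ultimately show ?thesis using row_cong[OF f] by (auto intro!: unit_rowI)
  qed
  with l that show ?thesis by blast
qed

text \<open>Divided by 3, the Eisenstein images of \<open>s0 + s1\<close> and \<open>s0 - s1\<close>
  have norm 4. Their coordinates are at most 2 in absolute value, being sums or differences of
  coordinates of \<open>unit_pairs\<close>.\<close>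

lemma plus_minus_classify:
  "(\<forall>f<5. even (eis_a s0 f + eis_a s1 f) \<and> even (eis_b s0 f + eis_b s1 f)) \<or>
    vec (\<lambda>f. (eis_a s0 f + eis_a s1 f, eis_b s0 f + eis_b s1 f)) \<in> set eis_sols"
  "(\<forall>f<5. even (eis_a s0 f - eis_a s1 f) \<and> even (eis_b s0 f - eis_b s1 f)) \<or>
    vec (\<lambda>f. (eis_a s0 f - eis_a s1 f, eis_b s0 f - eis_b s1 f)) \<in> set eis_sols"
proof -
  have l: "unit_row s0 f \<and> unit_row s1 f" if "f < 5" for f
    by (rule special_unit_rows) (use that in blast)
  have e: "s0 f 0 = s0 f 2 + 3 * eis_a s0 f" "s0 f 1 = s0 f 2 + 3 * eis_b s0 f" "s1 f 0 = s1 f 2 + 3 * eis_a s1 f" "s1 f 1 = s1 f 2 + 3 * eis_b s1 f"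
    if "f < 5" for f
    using l[OF that] by (simp_all add: unit_row_def)
  have le: "\<bar>eis_a s0 f\<bar> \<le> 1 \<and> \<bar>eis_b s0 f\<bar> \<le> 1" "\<bar>eis_a s1 f\<bar> \<le> 1 \<and> \<bar>eis_b s1 f\<bar> \<le> 1" if "f < 5" for f
    using l[OF that] unit_pairs_le by (auto simp: unit_row_def)
  have bd: "\<bar>eis_a s0 f + eis_a s1 f\<bar> \<le> 2 \<and> \<bar>eis_b s0 f + eis_b s1 f\<bar> \<le> 2" "\<bar>eis_a s0 f - eis_a s1 f\<bar> \<le> 2 \<and> \<bar>eis_b s0 f - eis_b s1 f\<bar> \<le> 2"
    if "f < 5" for f
    using le[OF that] by (rule_tac conjI; linarith)+
  show "(\<forall>f<5. even (eis_a s0 f + eis_a s1 f) \<and> even (eis_b s0 f + eis_b s1 f)) \<or>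
    vec (\<lambda>f. (eis_a s0 f + eis_a s1 f, eis_b s0 f + eis_b s1 f)) \<in> set eis_sols"
  proof (rule eis_classify[where a = "\<lambda>f. eis_a s0 f + eis_a s1 f" and b = "\<lambda>f. eis_b s0 f + eis_b s1 f", OF bd(1)])
    note E = eisenstein_corr[where x = "\<lambda>f j. s0 f j + s1 f j" and a = "\<lambda>f. eis_a s0 f + eis_a s1 f" and b = "\<lambda>f. eis_b s0 f + eis_b s1 f", OF plus_corr(1)]
    show "(\<Sum>f<5. (eis_a s0 f + eis_a s1 f) * (eis_a s0 ((f + p) mod 5) + eis_a s1 ((f + p) mod 5))) +
      (\<Sum>f<5. (eis_b s0 f + eis_b s1 f) * (eis_b s0 ((f + p) mod 5) + eis_b s1 ((f + p) mod 5))) -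
      (\<Sum>f<5. (eis_a s0 f + eis_a s1 f) * (eis_b s0 ((f + p) mod 5) + eis_b s1 ((f + p) mod 5))) = delta 4 p 0"
      if "p < 5" for p by (rule E(1)[OF _ _ _ _ that]) (simp_all add: e e[unfolded One_nat_def])
    show "(\<Sum>f<5. (eis_b s0 f + eis_b s1 f) * (eis_a s0 ((f + p) mod 5) + eis_a s1 ((f + p) mod 5))) =
      (\<Sum>f<5. (eis_a s0 f + eis_a s1 f) * (eis_b s0 ((f + p) mod 5) + eis_b s1 ((f + p) mod 5)))"
      if "p < 5" for p by (rule E(2)[OF _ _ _ _ that]) (simp_all add: e e[unfolded One_nat_def])
  qed
  show "(\<forall>f<5. even (eis_a s0 f - eis_a s1 f) \<and> even (eis_b s0 f - eis_b s1 f)) \<or>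
    vec (\<lambda>f. (eis_a s0 f - eis_a s1 f, eis_b s0 f - eis_b s1 f)) \<in> set eis_sols"
  proof (rule eis_classify[where a = "\<lambda>f. eis_a s0 f - eis_a s1 f" and b = "\<lambda>f. eis_b s0 f - eis_b s1 f", OF bd(2)])
    note E = eisenstein_corr[where x = "\<lambda>f j. s0 f j - s1 f j" and a = "\<lambda>f. eis_a s0 f - eis_a s1 f" and b = "\<lambda>f. eis_b s0 f - eis_b s1 f", OF plus_corr(2)]
    show "(\<Sum>f<5. (eis_a s0 f - eis_a s1 f) * (eis_a s0 ((f + p) mod 5) - eis_a s1 ((f + p) mod 5))) +
      (\<Sum>f<5. (eis_b s0 f - eis_b s1 f) * (eis_b s0 ((f + p) mod 5) - eis_b s1 ((f + p) mod 5))) -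
      (\<Sum>f<5. (eis_a s0 f - eis_a s1 f) * (eis_b s0 ((f + p) mod 5) - eis_b s1 ((f + p) mod 5))) = delta 4 p 0"
      if "p < 5" for p by (rule E(1)[OF _ _ _ _ that]) (simp_all add: e e[unfolded One_nat_def])
    show "(\<Sum>f<5. (eis_b s0 f - eis_b s1 f) * (eis_a s0 ((f + p) mod 5) - eis_a s1 ((f + p) mod 5))) =
      (\<Sum>f<5. (eis_a s0 f - eis_a s1 f) * (eis_b s0 ((f + p) mod 5) - eis_b s1 ((f + p) mod 5)))"
      if "p < 5" for p by (rule E(2)[OF _ _ _ _ that]) (simp_all add: e e[unfolded One_nat_def])
  qed
qed

end

section \<open>Excluding even Eisenstein images\<close>

lemma corr_even_cong:
  assumes "\<And>f j. f < 5 \<Longrightarrow> j < 3 \<Longrightarrow> even (x f j - x' f j)" "\<And>f j. f < 5 \<Longrightarrow> j < 3 \<Longrightarrow> even (y f j - y' f j)"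
  shows "even (corr x y p i - corr x' y' p i)"
  unfolding corr_def sum_subtractf[symmetric]
proof (intro dvd_sum)
  fix f j :: nat assume "f \<in> {..<5}" "j \<in> {..<3}"
  then have "even (x f j - x' f j)" "even (y ((f + p) mod 5) ((j + i) mod 3) - y' ((f + p) mod 5) ((j + i) mod 3))"
    using assms by auto
  then show "even (x f j * y ((f + p) mod 5) ((j + i) mod 3) - x' f j * y' ((f + p) mod 5) ((j + i) mod 3))"
    by auto
qed

lemma corr_gaussian_parity:
  assumes par: "\<And>f j. f < 5 \<Longrightarrow> j < 3 \<Longrightarrow> even (x f j - y f j)"
    and c: "4 dvd corr x x p i + corr y y p i" "corr x y p i = corr y x p i"
  shows "even (corr y y p i)"
proof -
  have e: "corr u v p i = (\<Sum>k\<in>{..<5}\<times>{..<3}. (\<lambda>(f, j). u f j) k * (\<lambda>(f, j). v f j) ((\<lambda>(f, j). ((f + p) mod 5, (j + i) mod 3)) k))" for u v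
    unfolding corr_def by (simp add: sum.cartesian_product case_prod_unfold)
  show ?thesis unfolding e
    by (rule gaussian_parity[where x = "\<lambda>(f, j). x f j"]) (use par c[unfolded e] in auto)
qed

text \<open>A row of sum 0 with Eisenstein integer z has squared length 6 N(z). If z and w agree
  modulo 2, both are zero or both are units, so the two rows contribute 0 or 12.\<close>

definition pair_parity_ok :: "int \<times> int \<Rightarrow> int \<times> int \<Rightarrow> bool" where
  "pair_parity_ok z w \<longleftrightarrow> \<not> (even (fst z + fst w) \<and> even (snd z + snd w)) \<or>
     6 * (fst z * fst z + snd z * snd z - fst z * snd z) + 6 * (fst w * fst w + snd w * snd w - fst w * snd w)
       = 12 * (if parity_row w = [0,0,0] then 0 else 1)"

lemma unit_pairs_parity:
  assumes "z \<in> unit_pairs" "w \<in> unit_pairs"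
  shows "pair_parity_ok z w"
proof -
  have "\<forall>z\<in>set [(0,0),(1,0),(-1,0),(0,1),(0,-1),(1,1),(-1,-1)]. \<forall>w\<in>set [(0,0),(1,0),(-1,0),(0,1),(0,-1),(1,1),(-1,-1)].
      pair_parity_ok z w"
    by code_simp
  moreover have "unit_pairs = set [(0,0),(1,0),(-1,0),(0,1),(0,-1),(1,1),(-1,-1)]"
    by (simp add: unit_pairs_def)
  ultimately show ?thesis using assms by blast
qed

lemma unit_pairs_parity_row:
  "(a, b) \<in> unit_pairs \<Longrightarrow> (parity_row (a, b), if parity_row (a, b) = [0,0,0] then 0 else 1) \<in> set parity_rows"
  by (auto simp: unit_pairs_def parity_row_def parity_rows_def)

context cw_arrays
begin

text \<open>If all entries are even, then \<open>d\<^sub>0 + \<i> d\<^sub>1\<close> is divisible by \<open>1 + \<i>\<close>, so the autocorrelation of \<open>d\<^sub>1\<close> is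
  even; but \<open>d\<^sub>1\<close> then has odd entries in exactly two rows, two in each.\<close>

lemma not_all_even:
  assumes ev: "\<And>f. f < 5 \<Longrightarrow> even (eis_a s0 f + eis_a s1 f) \<and> even (eis_b s0 f + eis_b s1 f)"
  shows False
proof -
  obtain l where l: "l < 5" "\<And>f. f < 5 \<Longrightarrow> f \<noteq> l \<Longrightarrow> row_sum s0 f = 0 \<and> row_sum s1 f = 0"
    "\<bar>row_sum s0 l\<bar> = 6 \<and> row_sum s1 l = 0 \<or> row_sum s0 l = 0 \<and> \<bar>row_sum s1 l\<bar> = 6"
    "\<And>f. f < 5 \<Longrightarrow> unit_row s0 f \<and> unit_row s1 f" using special_unit_rows by blast
  define r where "r f j = s1 f j mod 2" for f j
  define N :: "int list \<Rightarrow> int" where "N = (\<lambda>z. if z = [0,0,0] then 0 else 1)"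
  have prow: "map (\<lambda>j. s0 f j mod 2) [0..<3] = parity_row (eis_a s0 f, eis_b s0 f)"
    "map (\<lambda>j. s1 f j mod 2) [0..<3] = parity_row (eis_a s1 f, eis_b s1 f)" if "f < 5" for f
    using l(4)[OF that] unit_row_parity by blast+
  have same: "even (s0 f j - s1 f j)" if "f < 5" "j < 3" for f j
  proof -
    have "parity_row (eis_a s0 f, eis_b s0 f) = parity_row (eis_a s1 f, eis_b s1 f)"
    proof -
      have "eis_a s0 f mod 2 = eis_a s1 f mod 2" "eis_b s0 f mod 2 = eis_b s1 f mod 2"
        "(eis_a s0 f + eis_b s0 f) mod 2 = (eis_a s1 f + eis_b s1 f) mod 2"
        using ev[OF that(1)] by (auto simp: mod2_eq_if)
      then show ?thesis by (simp add: parity_row_def)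
    qed
    then have "map (\<lambda>j. s0 f j mod 2) [0..<3] = map (\<lambda>j. s1 f j mod 2) [0..<3]"
      using prow[OF that(1)] by simp
    then have "s0 f j mod 2 = s1 f j mod 2" using that(2) by (simp add: map_eq_conv)
    then show ?thesis by presburger
  qed
  have dsame: "even (d0 f j - d1 f j)" if "f < 5" "j < 3" for f j
    using same[OF that] entries0[OF that] entries1[OF that] by presburger
  have "even (corr r r p i)" if "p < 5" "i < 3" for p i
  proof -
    have "even (corr d1 d1 p i)"
    proof (rule corr_gaussian_parity[where x = d0])
      show "4 dvd corr d0 d0 p i + corr d1 d1 p i" unfolding d_corr[OF that] by (simp add: delta_def)
    qed (use dsame d_cross[OF that] in auto)
    moreover have "even (corr r r p i - corr d1 d1 p i)"
    proof (rule corr_even_cong)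
      show "even (r f j - d1 f j)" if "f < 5" "j < 3" for f j
        using entries1[OF that] unfolding r_def by presburger
      then show "even (r f j - d1 f j)" if "f < 5" "j < 3" for f j using that by blast
    qed
    ultimately show ?thesis by simp
  qed
  then have "\<not> autocorr_odd (rows r)"
    unfolding autocorr_odd_def list_corr_rows by (auto simp: shifts_def list_ex_iff)
  moreover have "autocorr_odd (rows r)"
  proof -
    have rr: "rows r = map (\<lambda>f. parity_row (eis_a s1 f, eis_b s1 f)) [0..<5]"
      unfolding rows_def r_def using prow(2) by (intro map_cong) auto
    have "(\<Sum>j<3. s0 f j * s0 f j) + (\<Sum>j<3. s1 f j * s1 f j)
        = 12 * N (parity_row (eis_a s1 f, eis_b s1 f)) + (if f = l then 12 else 0)" if f: "f < 5" for f
    proof -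
      have u: "unit_row s0 f" "unit_row s1 f" using l(4)[OF f] by auto
      have n: "(\<Sum>j<3. x f j * x f j) = 6 * (eis_a x f * eis_a x f + eis_b x f * eis_b x f - eis_a x f * eis_b x f)
          + (if row_sum x f = 0 then 0 else 12)" if x: "unit_row x f" for x
      proof (cases "row_sum x f = 0")
        case True
        then have xf: "x f 0 = 2 * eis_a x f - eis_b x f" "x f 1 = 2 * eis_b x f - eis_a x f" "x f 2 = - eis_a x f - eis_b x f"
          using x unfolding unit_row_def by linarith+
        show ?thesis unfolding sum_less3 xf using True by (simp add: algebra_simps)
      next
        case False
        then have "x f 2 = 2 \<or> x f 2 = - 2" using x unfolding unit_row_def by linarith
        then show ?thesis using False x unfolding unit_row_def sum_less3 by auto
      qed
      have "6 * (eis_a s0 f * eis_a s0 f + eis_b s0 f * eis_b s0 f - eis_a s0 f * eis_b s0 f) + 6 * (eis_a s1 f * eis_a s1 f + eis_b s1 f * eis_b s1 f - eis_a s1 f * eis_b s1 f)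
        = 12 * N (parity_row (eis_a s1 f, eis_b s1 f))"
      proof -
        have "pair_parity_ok (eis_a s0 f, eis_b s0 f) (eis_a s1 f, eis_b s1 f)"
          using u by (auto simp: unit_row_def intro: unit_pairs_parity)
        then show ?thesis using ev[OF f] by (simp add: pair_parity_ok_def N_def)
      qed
      \<comment> \<open>In the exceptional row one component has three entries 2 or three entries
        -2, which adds 12.\<close>
      moreover have "(if row_sum s0 f = 0 then 0 else 12) + (if row_sum s1 f = 0 then 0 else 12) = (if f = l then 12 else 0::int)"
        using l(2)[OF f] l(3) by (cases "f = l") auto
      ultimately show ?thesis using n[OF u(1)] n[OF u(2)] by linarith
    qed
    then have "corr s0 s0 0 0 + corr s1 s1 0 0 = (\<Sum>f<5. 12 * N (parity_row (eis_a s1 f, eis_b s1 f)) + (if f = l then 12 else 0))"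
      unfolding corr_def sum.distrib[symmetric] by (intro sum.cong) (auto simp: sum.distrib)
    \<comment> \<open>Removing the exceptional 12 from 36 leaves 24, so exactly two rows are
      odd.\<close>
    then have "12 * (\<Sum>f<5. N (parity_row (eis_a s1 f, eis_b s1 f))) + 12 = 36"
      using s_corr[of 0 0] l(1) by (simp add: sum.distrib sum_distrib_left delta_def)
    then have two: "sum_list (map N (rev (rows r))) = 2"
      unfolding rr by (simp add: rev_map[symmetric] interv_sum_list_conv_sum_set_nat atLeast0LessThan o_def)
    have "autocorr_odd (rev (rev (rows r)) @ [])"
    proof (rule norm_search_sound[OF two_odd_rows _ _ _ two])
      show "(z, N z) \<in> set parity_rows" if z: "z \<in> set (rev (rows r))" for z
      proof -
        obtain f where f: "f < 5" "z = parity_row (eis_a s1 f, eis_b s1 f)" using z unfolding rr by auto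
        then have "(eis_a s1 f, eis_b s1 f) \<in> unit_pairs" using l(4)[OF f(1)] by (simp add: unit_row_def)
        from unit_pairs_parity_row[OF this] show ?thesis unfolding f(2) N_def .
      qed
    qed (auto simp: rows_def N_def)
    then show ?thesis by simp
  qed
  ultimately show False by simp
qed

text \<open>Sum and difference agree modulo 2, and \<open>not_all_even\<close> excludes even ones.
  By \<open>eis_pairs\<close> they agree up to sign, so one of the two summands vanishes.\<close>

lemma one_side_zero:
  "(\<forall>f<5. eis_a s1 f = 0 \<and> eis_b s1 f = 0) \<and> vec (\<lambda>f. (eis_a s0 f, eis_b s0 f)) \<in> set eis_sols \<or>
   (\<forall>f<5. eis_a s0 f = 0 \<and> eis_b s0 f = 0) \<and> vec (\<lambda>f. (eis_a s1 f, eis_b s1 f)) \<in> set eis_sols"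
proof -
  let ?P = "vec (\<lambda>f. (eis_a s0 f + eis_a s1 f, eis_b s0 f + eis_b s1 f))"
  let ?M = "vec (\<lambda>f. (eis_a s0 f - eis_a s1 f, eis_b s0 f - eis_b s1 f))"
  have "?P \<in> set eis_sols" using plus_minus_classify(1) not_all_even by blast
  moreover have "?M \<in> set eis_sols"
  proof -
    have "\<not> (\<forall>f<5. even (eis_a s0 f - eis_a s1 f) \<and> even (eis_b s0 f - eis_b s1 f))"
      using not_all_even by (metis even_add even_diff)
    then show ?thesis using plus_minus_classify(2) by blast
  qed
  ultimately have "eis_pair_good ?P ?M" using eis_pairs by (auto simp: list_all_iff)
  moreover have "list_all2 eis_cong ?P ?M"
    by (simp add: vec_def list_all2_conv_all_nth eis_cong_def)
  ultimately have "?M = ?P \<or> ?M = map eis_neg ?P" by (simp add: eis_pair_good_def)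
  then show ?thesis
  proof
    assume "?M = ?P"
    then have z: "eis_a s1 f = 0 \<and> eis_b s1 f = 0" if "f < 5" for f
      using that by (auto simp: vec_def map_eq_conv)
    then have "?P = vec (\<lambda>f. (eis_a s0 f, eis_b s0 f))" by (auto simp: vec_def)
    with \<open>?P \<in> set eis_sols\<close> z show ?thesis by auto
  next
    assume "?M = map eis_neg ?P"
    then have z: "eis_a s0 f = 0 \<and> eis_b s0 f = 0" if "f < 5" for f
      using that by (auto simp: vec_def map_eq_conv eis_neg_def)
    then have "?P = vec (\<lambda>f. (eis_a s1 f, eis_b s1 f))" by (auto simp: vec_def)
    with \<open>?P \<in> set eis_sols\<close> z show ?thesis by auto
  qed
qed

end

section \<open>Gaussian integers of norm 9 over \<open>C\<^sub>5\<close>\<close>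

lemma gauss_classify:
  assumes c: "\<And>p. p < 5 \<Longrightarrow> (\<Sum>f<5. a f * a ((f + p) mod 5)) + (\<Sum>f<5. b f * b ((f + p) mod 5)) = delta 9 p 0"
    "\<And>p. p < 5 \<Longrightarrow> (\<Sum>f<5. a f * b ((f + p) mod 5)) = (\<Sum>f<5. b f * a ((f + p) mod 5))"
  shows "(vec a, vec b) \<in> set gauss_sols"
proof -
  define N :: "int \<Rightarrow> int" where "N z = z * z" for z
  have N0: "0 \<le> N z" for z by (simp add: N_def)
  have S: "(\<Sum>f<5. N (a f)) + (\<Sum>f<5. N (b f)) = 9" using c(1)[of 0] by (simp add: N_def delta_def)
  have L: "(z, N z) \<in> set int_norms" if "N z \<le> 9" for z
  proof -
    have "\<bar>z\<bar> \<le> 3"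
    proof (rule ccontr)
      assume "\<not> \<bar>z\<bar> \<le> 3"
      then have "4 * 4 \<le> \<bar>z\<bar> * \<bar>z\<bar>" by (intro mult_mono) auto
      then show False using that by (simp add: N_def abs_mult_self_eq)
    qed
    then have "z \<in> {-3,-2,-1,0,1,2,3}" by auto
    then show ?thesis by (auto simp: N_def int_norms_def)
  qed
  have main: "(vec u, vec v) \<in> set gauss_sols \<and> (vec v, vec u) \<in> set gauss_sols"
    if su: "\<bar>\<Sum>f<5. u f\<bar> = 3" and sv: "(\<Sum>f<5. v f) = 0"
      and nrm: "(\<Sum>f<5. N (u f)) + (\<Sum>f<5. N (v f)) = 9"
      and cc: "\<And>p. p \<in> {1,2} \<Longrightarrow> (\<Sum>f<5. u f * u ((f + p) mod 5)) + (\<Sum>f<5. v f * v ((f + p) mod 5)) = 0"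
        "\<And>p. p \<in> {1,2} \<Longrightarrow> (\<Sum>f<5. u f * v ((f + p) mod 5)) = (\<Sum>f<5. v f * u ((f + p) mod 5))"
    for u v :: "nat \<Rightarrow> int"
  proof -
    have sl: "sum_list (map N (rev (vec w))) = (\<Sum>f<5. N (w f))" for w
      by (simp add: vec_def rev_map[symmetric] interv_sum_list_conv_sum_set_nat atLeast0LessThan o_def)
    have sl': "sum_list (vec w) = (\<Sum>f<5. w f)" for w :: "nat \<Rightarrow> int"
      by (simp add: vec_def interv_sum_list_conv_sum_set_nat atLeast0LessThan)
    have nn: "0 \<le> (\<Sum>f<5. N (u f))" "0 \<le> (\<Sum>f<5. N (v f))" by (auto intro: sum_nonneg N0)
    have mem: "(z, N z) \<in> set int_norms" if z: "z \<in> set (rev (vec w))" and w: "(\<Sum>f<5. N (w f)) \<le> 9" for z w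
    proof -
      obtain f where f: "f < 5" "z = w f" using z by (auto simp: vec_def)
      then have "N z \<le> 9" using member_le_sum[of f "{..<5}" "\<lambda>f. N (w f)"] N0 w by auto
      then show ?thesis by (rule L)
    qed
    have "even (\<Sum>f<5. N (u f) - u f)" by (intro dvd_sum) (simp add: N_def)
    then have "odd (\<Sum>f<5. N (u f))" using su unfolding sum_subtractf by presburger
    then have "(\<Sum>f<5. N (u f)) \<in> set [1,3,5,7,9]" using nn nrm by simp presburger
    then have "norm_search gauss_first int_norms 5 (\<Sum>f<5. N (u f)) []"
      using gauss_search unfolding list_all_iff by blast
    then have "gauss_first (rev (rev (vec u)) @ [])"
      by (rule norm_search_sound[where N = N]) (use mem[of _ u] nn nrm sl in \<open>auto simp: N0 vec_def\<close>)
    moreover have "sum_list (vec u) = 3 \<or> sum_list (vec u) = -3" using su unfolding sl' by linarith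
    moreover have "dot (vec u) (vec u) = (\<Sum>f<5. N (u f))"
      using dot_vec[of u 0 u] by (simp add: N_def)
    ultimately have "norm_search (gauss_good (vec u)) int_norms 5 (9 - (\<Sum>f<5. N (u f))) []"
      unfolding gauss_first_def by auto
    then have "gauss_good (vec u) (rev (rev (vec v)) @ [])"
      by (rule norm_search_sound[where N = N]) (use mem[of _ v] nn nrm sl in \<open>auto simp: N0 vec_def\<close>)
    moreover have "gauss_ok (vec u) (vec v)"
      using cc(1)[of 1] cc(1)[of 2] cc(2)[of 1] cc(2)[of 2] by (simp add: gauss_ok_def dot_vec)
    ultimately show ?thesis using sl'[of v] sv by (simp add: gauss_good_def)
  qed
  define A B where "A = (\<Sum>f<5. a f)" and "B = (\<Sum>f<5. b f)"
  \<comment> \<open>Summing over all shifts is the augmentation map.\<close>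
  have "A * A + B * B = (\<Sum>p<5. (\<Sum>f<5. a f * a ((f + p) mod 5)) + (\<Sum>f<5. b f * b ((f + p) mod 5)))"
  proof -
    have "(\<Sum>p<5. \<Sum>f<5. w f * w ((f + p) mod 5)) = (\<Sum>f<5. w f) * (\<Sum>f<5. w f)" for w :: "nat \<Rightarrow> int"
    proof -
      have "(\<Sum>p<5. \<Sum>f<5. w f * w ((f + p) mod 5)) = (\<Sum>f<5. w f * (\<Sum>p<5. w ((p + f) mod 5)))"
        by (subst sum.swap) (simp add: sum_distrib_left add.commute)
      then show ?thesis by (simp add: sum_rotate sum_distrib_right)
    qed
    then show ?thesis by (simp add: A_def B_def sum.distrib)
  qed
  also have "\<dots> = 9" using c(1) by (simp add: sum_less5 delta_def)
  finally have AB: "A * A + B * B = 9" .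
  then have "N A \<le> 9" "N B \<le> 9" using N0[of A] N0[of B] unfolding N_def by linarith+
  then have "(A, N A) \<in> set int_norms" "(B, N B) \<in> set int_norms" using L by auto
  then have "\<bar>A\<bar> = 3 \<and> B = 0 \<or> A = 0 \<and> \<bar>B\<bar> = 3"
    using AB unfolding N_def[symmetric] int_norms_def by auto
  moreover have p1: "(\<Sum>f<5. a f * a ((f + p) mod 5)) + (\<Sum>f<5. b f * b ((f + p) mod 5)) = 0"
    "(\<Sum>f<5. b f * b ((f + p) mod 5)) + (\<Sum>f<5. a f * a ((f + p) mod 5)) = 0"
    "(\<Sum>f<5. a f * b ((f + p) mod 5)) = (\<Sum>f<5. b f * a ((f + p) mod 5))" if "p \<in> {1,2}" for p
  proof -
    have "p < 5" "p \<noteq> 0" using that by auto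
    with c[of p] show "(\<Sum>f<5. a f * a ((f + p) mod 5)) + (\<Sum>f<5. b f * b ((f + p) mod 5)) = 0"
      "(\<Sum>f<5. b f * b ((f + p) mod 5)) + (\<Sum>f<5. a f * a ((f + p) mod 5)) = 0"
      "(\<Sum>f<5. a f * b ((f + p) mod 5)) = (\<Sum>f<5. b f * a ((f + p) mod 5))"
      by (simp_all add: delta_def)
  qed
  ultimately show ?thesis
    using main[OF _ _ S p1(1) p1(3)] main[OF _ _ S[unfolded add.commute[of "\<Sum>f<5. N (a f)"]] p1(2) p1(3)[symmetric]]
    unfolding A_def B_def by blast
qed

section \<open>An odd component with a given mask and an even component\<close>

lemma corr_scale: "corr (\<lambda>f j. c * x f j) y p i = c * corr x y p i" "corr x (\<lambda>f j. c * y f j) p i = c * corr x y p i"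
  by (simp_all add: corr_def sum_distrib_left ac_simps)

lemma mask_sums:
  assumes "rows u = parity_mask e" "f < 5"
  shows "(\<Sum>j<3. u f j) = (if f = 0 then 0 else 2)" and "j < 3 \<Longrightarrow> u 0 j = 0"
proof -
  have "f \<in> {0,1,2,3,4}" using \<open>f < 5\<close> by auto
  then show "(\<Sum>j<3. u f j) = (if f = 0 then 0 else 2)"
    using assms(1) by (cases "e = 1") (auto simp: rows_def parity_mask_def upt5 upt3 sum_less3)
  assume "j < 3"
  then have "j \<in> {0,1,2}" by auto
  then show "u 0 j = 0"
    using assms(1) by (cases "e = 1") (auto simp: rows_def parity_mask_def upt5 upt3)
qed

lemma sum_list_row: "sum_list (map g [0..<3]) = (\<Sum>j<3. g j)" for g :: "nat \<Rightarrow> int"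
  by (simp add: interv_sum_list_conv_sum_set_nat atLeast0LessThan)

lemma shifts_bound: "(p, i) \<in> set shifts \<Longrightarrow> p < 5 \<and> i < 3 \<and> (p, i) \<noteq> (0, 0)"
  by (auto simp: shifts_def)

text \<open>Halved row sums of x and t form an element of norm 9 in Z[i][C5], so
  \<open>gauss_classify\<close> lists them. The remaining constraints become the tests that
  \<open>final_good\<close> shows to be incompatible.\<close>

lemma masked_contradiction:
  fixes x t :: "nat \<Rightarrow> nat \<Rightarrow> int"
  assumes c: "\<And>p i. p < 5 \<Longrightarrow> i < 3 \<Longrightarrow> corr x x p i + corr t t p i = delta 36 p i"
    and cross: "\<And>p i. p < 5 \<Longrightarrow> i < 3 \<Longrightarrow> corr x t p i = corr t x p i"
    and e: "e = 1 \<or> e = 2"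
    and mask: "rows (\<lambda>f j. x f j mod 2) = parity_mask e"
    and xb: "\<And>f j. f < 5 \<Longrightarrow> j < 3 \<Longrightarrow> \<bar>x f j\<bar> \<le> 2"
    and x0: "\<And>f j. f < 5 \<Longrightarrow> j < 3 \<Longrightarrow> f \<noteq> 0 \<Longrightarrow> even (x f j) \<Longrightarrow> x f j = 0"
    and t: "\<And>f j. f < 5 \<Longrightarrow> j < 3 \<Longrightarrow> even (t f j) \<and> \<bar>t f j\<bar> \<le> 2"
    and l: "l < 5" "(\<forall>j<3. x l j = 0) \<or> (\<forall>j<3. t l j = 0)"
  shows False
proof -
  define u where "u f j = x f j mod 2" for f j
  define h where "h f j = t f j div 2" for f j
  define X where "X f = row_sum x f div 2" for f
  define Y where "Y f = row_sum h f" for f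
  have mask': "rows u = parity_mask e" using mask by (simp add: u_def[abs_def])
  have th: "t f j = 2 * h f j" "\<bar>h f j\<bar> \<le> 1" if "f < 5" "j < 3" for f j
  proof -
    show "t f j = 2 * h f j" using t[OF that] by (simp add: h_def)
    then show "\<bar>h f j\<bar> \<le> 1" using t[OF that] by linarith
  qed
  have X: "row_sum x f = 2 * X f" if "f < 5" for f
  proof -
    \<comment> \<open>Every mask row has sum 0 or 2, so the row sums of x are even.\<close>
    have "even (\<Sum>j<3. x f j - u f j)" by (intro dvd_sum) (simp add: u_def)
    then have "even (row_sum x f)" using mask_sums(1)[OF mask' that] by (simp add: row_sum_def sum_subtractf split: if_splits)
    then show ?thesis by (simp add: X_def)
  qed
  have Y: "row_sum t f = 2 * Y f" if "f < 5" for f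
    using th(1)[OF that] by (simp add: Y_def row_sum_def sum_distrib_left)
  have cth: "corr t t p i = 4 * corr h h p i" "corr x t p i = 2 * corr x h p i" "corr t x p i = 2 * corr h x p i" for p i
  proof -
    have e: "corr y t p i = corr y (\<lambda>f j. 2 * h f j) p i" "corr t y p i = corr (\<lambda>f j. 2 * h f j) y p i" for y
      unfolding corr_def by (intro sum.cong refl; simp add: th)+
    show "corr t t p i = 4 * corr h h p i" "corr x t p i = 2 * corr x h p i" "corr t x p i = 2 * corr h x p i"
      using e(1)[of t] e(2)[of h] e(1)[of x] e(2)[of x] by (simp_all add: corr_scale)
  qed
  have off: "corr x x p i + 4 * corr h h p i = 0" "corr x h p i = corr h x p i" if "(p, i) \<in> set shifts" for p i
    using shifts_bound[OF that] c[of p i] cross[of p i] cth[of p i] by (auto simp: delta_def)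
  have "(vec X, vec Y) \<in> set gauss_sols"
  proof (rule gauss_classify)
    fix p :: nat assume p: "p < 5"
    have XY: "(\<Sum>i<3. corr x x p i) = 4 * (\<Sum>f<5. X f * X ((f + p) mod 5))" "(\<Sum>i<3. corr t t p i) = 4 * (\<Sum>f<5. Y f * Y ((f + p) mod 5))"
      "(\<Sum>i<3. corr x t p i) = 4 * (\<Sum>f<5. X f * Y ((f + p) mod 5))" "(\<Sum>i<3. corr t x p i) = 4 * (\<Sum>f<5. Y f * X ((f + p) mod 5))"
      unfolding corr_row_sum sum_distrib_left by (intro sum.cong refl; simp add: X Y)+
    have "(\<Sum>i<3. corr x x p i) + (\<Sum>i<3. corr t t p i) = (\<Sum>i<3. delta 36 p i)"
      unfolding sum.distrib[symmetric] using p c by (intro sum.cong) auto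
    also have "\<dots> = delta 36 p 0" by (simp add: sum_less3 delta_def)
    finally show "(\<Sum>f<5. X f * X ((f + p) mod 5)) + (\<Sum>f<5. Y f * Y ((f + p) mod 5)) = delta 9 p 0"
      unfolding XY by (auto simp: delta_def split: if_splits)
    have "(\<Sum>i<3. corr x t p i) = (\<Sum>i<3. corr t x p i)" using p cross by (intro sum.cong) auto
    then show "(\<Sum>f<5. X f * Y ((f + p) mod 5)) = (\<Sum>f<5. Y f * X ((f + p) mod 5))"
      unfolding XY by simp
  qed
  moreover have "final_good e" using e final_search1 final_search2 by auto
  ultimately have cands: "cands_good e (vec Y) (odd_cands e (vec X))"
    unfolding final_good_def list_all_iff by auto
  have "rows x \<in> set (odd_cands e (vec X))"
  proof -
    have "mod4_ok (rows x)"
      unfolding mod4_ok_def list_all_iff list_corr_rows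
    proof clarify
      fix p i assume "(p, i) \<in> set shifts"
      from off(1)[OF this] have "corr x x p i = 4 * (- corr h h p i)" by simp
      then show "4 dvd corr x x p i" by simp
    qed
    moreover
    let ?g = "\<lambda>u. if u = 1 then [1, -1] else [0::int]"
    have rowf: "map (x f) [0..<3] \<in> set (mask_rows (map ?g (map (u f) [0..<3])) (X f))" if f: "f < 5" "f \<noteq> 0" for f
    proof -
      have "x f j \<in> set (?g (u f j))" if "j < 3" for j
      proof (cases "even (x f j)")
        case True
        then show ?thesis using x0[OF f(1) that f(2)] by (simp add: u_def)
      next
        case False
        then have "x f j = 1 \<or> x f j = -1" using xb[OF f(1) that] by presburger
        then show ?thesis by (auto simp: u_def)
      qed
      then have "list_all2 (\<lambda>x ys. x \<in> set ys) (map (x f) [0..<3]) (map ?g (map (u f) [0..<3]))"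
        by (simp add: list_all2_conv_all_nth)
      moreover have "sum_list (map (x f) [0..<3]) = 2 * X f"
        using X[OF f(1)] by (simp only: sum_list_row row_sum_def)
      ultimately show ?thesis by (simp only: mask_rows_def set_filter product_lists_set mem_Collect_eq)
    qed
    have row0: "map (x 0) [0..<3] \<in> set (mask_rows [[0,2,-2],[0,2,-2],[0,2,-2]] (X 0))"
    proof -
      have "x 0 j \<in> set [0,2,-2]" if "j < 3" for j
        using xb[of 0 j] mask_sums(2)[OF mask' _ that] that unfolding u_def by simp presburger
      then have "list_all2 (\<lambda>x ys. x \<in> set ys) (map (x 0) [0..<3]) [[0,2,-2],[0,2,-2],[0,2,-2]]"
        by (simp add: upt3)
      moreover have "sum_list (map (x 0) [0..<3]) = 2 * X 0"
        using X[of 0] by (simp only: sum_list_row row_sum_def zero_less_numeral)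
      ultimately show ?thesis by (simp only: mask_rows_def set_filter product_lists_set mem_Collect_eq)
    qed
    have "rows x \<in> set (product_lists (mask_rows [[0,2,-2],[0,2,-2],[0,2,-2]] (hd (vec X)) #
        map2 (\<lambda>r. mask_rows (map ?g r)) (tl (rows u)) (tl (vec X))))"
      using row0 rowf[of 1] rowf[of 2] rowf[of 3] rowf[of 4]
      unfolding product_lists_set mem_Collect_eq by (simp add: rows_def vec_def upt5)
    ultimately show ?thesis unfolding odd_cands_def mask' by simp
  qed
  moreover obtain w where w: "w \<in> set [0,1,2,3]" "row_weight (map (x 0) [0..<3]) = 2 * w"
  proof -
    have "\<exists>a. \<bar>x 0 j\<bar> = 2 * a \<and> 0 \<le> a \<and> a \<le> 1" if "j < 3" for j
      using xb[of 0 j] mask_sums(2)[OF mask' _ that] that unfolding u_def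
      by (intro exI[of _ "\<bar>x 0 j\<bar> div 2"]) (simp, presburger)
    from this[of 0] this[of 1] this[of 2] obtain a b d where
      "\<bar>x 0 0\<bar> = 2 * a" "0 \<le> a" "a \<le> 1" "\<bar>x 0 1\<bar> = 2 * b" "0 \<le> b" "b \<le> 1" "\<bar>x 0 2\<bar> = 2 * d" "0 \<le> d" "d \<le> 1"
      by auto
    then show ?thesis by (intro that[of "a + b + d"]) (auto simp: row_weight_def upt3)
  qed
  define os where "os = filter (\<lambda>x. row_weight (hd x) = 2 * w) (odd_cands e (vec X))"
  have "rows x \<in> set os"
    using calculation w(2) unfolding os_def by (simp add: rows_def upt5)
  moreover have "weight_good e (vec Y) w os"
    using cands w(1) unfolding cands_good_def list_all_iff os_def by blast
  ultimately have "row_search (even_good e os) (rev (map tern_rows (vec Y))) (7 - w) []"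
    unfolding weight_good_def by auto
  then have "even_good e os (rev (rev (rows h)) @ [])"
  proof (rule row_search_sound[where N = row_weight])
    have "(map (h f) [0..<3], row_weight (map (h f) [0..<3])) \<in> set (tern_rows (Y f))" if "f < 5" for f
    proof -
      have "h f j \<in> set [0,1,-1]" if "j < 3" for j using th(2)[OF \<open>f < 5\<close> that] by auto
      then have "map (h f) [0..<3] \<in> set (product_lists [[0,1,-1],[0,1,-1],[0,1,-1]])"
        unfolding product_lists_set mem_Collect_eq by (simp add: upt3)
      moreover have "sum_list (map (h f) [0..<3]) = Y f" by (simp only: sum_list_row Y_def row_sum_def)
      ultimately show ?thesis unfolding tern_rows_def set_map set_filter by blast
    qed
    then have "list_all2 (\<lambda>x L. (x, row_weight x) \<in> set L) (rows h) (map tern_rows (vec Y))"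
      by (simp add: rows_def vec_def list_all2_conv_all_nth)
    then show "list_all2 (\<lambda>x L. (x, row_weight x) \<in> set L) (rev (rows h)) (rev (map tern_rows (vec Y)))"
      by (simp only: list_all2_rev)
    show "0 \<le> row_weight r" for r by (auto simp: row_weight_def intro!: sum_list_nonneg)
    \<comment> \<open>Row 0 has entries 0, 2, -2, so its squares sum to twice its absolute sum 2w;
      every other row has two entries 1 or -1 and a zero.\<close>
    have sqx: "(\<Sum>j<3. x f j * x f j) = (if f = 0 then 4 * w else 2)" if f: "f < 5" for f
    proof (cases "f = 0")
      case True
      have "x 0 j * x 0 j = 2 * \<bar>x 0 j\<bar>" if "j < 3" for j
      proof -
        have "x 0 j = 0 \<or> x 0 j = 2 \<or> x 0 j = -2"
          using xb[of 0 j] mask_sums(2)[OF mask' _ that] that unfolding u_def by simp presburger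
        then show ?thesis by auto
      qed
      then have "(\<Sum>j<3. x 0 j * x 0 j) = 2 * row_weight (map (x 0) [0..<3])"
        by (simp add: row_weight_def sum_less3 upt3)
      then show ?thesis using True w(2) by simp
    next
      case False
      have "x f j * x f j = u f j" if "j < 3" for j
      proof (cases "even (x f j)")
        case True
        then show ?thesis using x0[OF f that False] by (simp add: u_def)
      next
        case odd: False
        then have "x f j = 1 \<or> x f j = -1" using xb[OF f that] by presburger
        then show ?thesis by (auto simp: u_def)
      qed
      then show ?thesis using mask_sums(1)[OF mask' f] False by simp
    qed
    have sqh: "(\<Sum>j<3. h f j * h f j) = row_weight (map (h f) [0..<3])" if f: "f < 5" for f
    proof -
      have "h f j * h f j = \<bar>h f j\<bar>" if "j < 3" for j
      proof -
        have "h f j = 0 \<or> h f j = 1 \<or> h f j = -1" using th(2)[OF f that] by linarith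
        then show ?thesis by auto
      qed
      then show ?thesis by (simp add: row_weight_def sum_less3 upt3)
    qed
    have "corr x x 0 0 = (\<Sum>f<(5::nat). if f = 0 then 4 * w else 2)"
      unfolding corr_def using sqx by (intro sum.cong) auto
    then have "corr x x 0 0 = 4 * w + 8" by (simp add: sum_less5)
    moreover have "corr h h 0 0 = (\<Sum>f<5. row_weight (map (h f) [0..<3]))"
      unfolding corr_def using sqh by (intro sum.cong) auto
    ultimately have "(\<Sum>f<5. row_weight (map (h f) [0..<3])) = 7 - w"
      using c[of 0 0] cth(1)[of 0 0] by (simp add: delta_def)
    then show "sum_list (map row_weight (rev (rows h))) = 7 - w"
      by (simp add: rows_def rev_map[symmetric] interv_sum_list_conv_sum_set_nat atLeast0LessThan o_def)
  qed
  then have "even_good e os (rows h)" by simp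
  moreover have "sym2_ok (parity_mask e) (rows h)"
    unfolding sym2_ok_def list_all_iff mask'[symmetric] list_corr_rows
  proof clarify
    fix p i assume pi: "(p, i) \<in> set shifts"
    have "even (corr u h p i - corr x h p i)" "even (corr h u p i - corr h x p i)"
      by (rule corr_even_cong; simp add: u_def)+
    then show "even (corr u h p i - corr h u p i)" using off(2)[OF pi] by presburger
  qed
  moreover have "has_zero_row (rows x) \<or> has_zero_row (rows h)"
  proof -
    have z: "has_zero_row (rows y)" if "\<forall>j<3. y l j = 0" for y
    proof -
      have "map (y l) [0..<3] = [0,0,0]" using that by (simp add: upt3)
      then show ?thesis using l(1) unfolding has_zero_row_def rows_def list_ex_iff by force
    qed
    have "\<forall>j<3. h l j = 0" if "\<forall>j<3. t l j = 0" using that by (simp add: h_def)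
    then show ?thesis using l(2) z by blast
  qed
  moreover have "full_ok (rows x) (rows h)"
    unfolding full_ok_def list_all_iff list_corr_rows using off by auto
  ultimately show False
    using \<open>rows x \<in> set os\<close> unfolding even_good_def list_all_iff by blast
qed

context cw_arrays
begin

text \<open>The vanishing side makes \<open>s1\<close>, hence \<open>d1\<close>, even, while the
  parities of \<open>d0\<close> form a mask up to translation. After translating both,
  \<open>masked_contradiction\<close> applies with \<open>d0\<close> as the odd component.\<close>

lemma one_side_contradiction:
  assumes z1: "\<And>f. f < 5 \<Longrightarrow> eis_a s1 f = 0 \<and> eis_b s1 f = 0"
    and z0: "vec (\<lambda>f. (eis_a s0 f, eis_b s0 f)) \<in> set eis_sols"
  shows False
proof -
  obtain l where l: "l < 5" "\<And>f. f < 5 \<Longrightarrow> f \<noteq> l \<Longrightarrow> row_sum s0 f = 0 \<and> row_sum s1 f = 0"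
    "\<bar>row_sum s0 l\<bar> = 6 \<and> row_sum s1 l = 0 \<or> row_sum s0 l = 0 \<and> \<bar>row_sum s1 l\<bar> = 6"
    "\<And>f. f < 5 \<Longrightarrow> unit_row s0 f \<and> unit_row s1 f" using special_unit_rows by blast
  define r where "r f j = s0 f j mod 2" for f j
  have "map parity_row (vec (\<lambda>f. (eis_a s0 f, eis_b s0 f))) = rows r"
  proof -
    have "map (\<lambda>j. r f j) [0..<3] = parity_row (eis_a s0 f, eis_b s0 f)" if "f < 5" for f
      unfolding r_def using unit_row_parity[of s0 f] l(4)[OF that] by blast
    then show ?thesis unfolding vec_def rows_def by simp
  qed
  moreover have "\<exists>m k e. map (rotate k) (rotate m (map parity_row (vec (\<lambda>f. (eis_a s0 f, eis_b s0 f))))) = parity_mask e \<and> e \<in> set [1, 2]"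
    using bspec[OF eis_sols_mask[unfolded list_all_iff] z0] unfolding list_ex_iff by blast
  ultimately obtain m k e where mke: "map (rotate k) (rotate m (rows r)) = parity_mask e" "e = 1 \<or> e = 2" by auto
  define x where "x f j = d0 ((f + m) mod 5) ((j + k) mod 3)" for f j
  define t where "t f j = d1 ((f + m) mod 5) ((j + k) mod 3)" for f j
  have par: "d0 f j mod 2 = r f j" if "f < 5" "j < 3" for f j
    using entries0[OF that] unfolding r_def by presburger
  have "map (rotate k) (rotate m (rows r)) = rows (\<lambda>f j. r ((f + m) mod 5) ((j + k) mod 3))"
    unfolding rows_def rotate_map_upt by (simp add: rotate_map_upt[of k _ 3])
  also have "\<dots> = rows (\<lambda>f j. x f j mod 2)"
    unfolding rows_def x_def by (simp add: par)
  finally have mask: "rows (\<lambda>f j. x f j mod 2) = parity_mask e" using mke(1) by simp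
  \<comment> \<open>In a row with odd entries the even entry of \<open>s0\<close> is 2 or -2, as in
    (2, -1, -1), so the entry bound forces 0 in \<open>d0\<close>.\<close>
  have zero_if_even: "d0 f j = 0" if f: "f < 5" "j < 3" and ev: "even (d0 f j)" and odd: "i < 3" "odd (d0 f i)" for f j i
  proof -
    have u: "unit_row s0 f" using l(4) f by blast
    have odd': "odd (s0 f i)" using entries0[OF f(1) \<open>i < 3\<close>] odd by presburger
    have "row_sum s0 f = 0"
    proof (rule ccontr)
      assume "row_sum s0 f \<noteq> 0"
      then have s: "s0 f 0 = s0 f 2" "s0 f 1 = s0 f 2" "s0 f 2 = 2 \<or> s0 f 2 = -2" using u unfolding unit_row_def by linarith+
      have "i = 0 \<or> i = 1 \<or> i = 2" using \<open>i < 3\<close> by linarith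
      then show False using odd' s by auto
    qed
    then have s: "s0 f 2 = - eis_a s0 f - eis_b s0 f" "s0 f 0 = 2 * eis_a s0 f - eis_b s0 f" "s0 f 1 = 2 * eis_b s0 f - eis_a s0 f"
      and ab: "(eis_a s0 f, eis_b s0 f) \<in> unit_pairs"
      using u unfolding unit_row_def by linarith+
    have "(eis_a s0 f, eis_b s0 f) \<noteq> (0, 0)"
    proof
      assume "(eis_a s0 f, eis_b s0 f) = (0, 0)"
      moreover have "i = 0 \<or> i = 1 \<or> i = 2" using \<open>i < 3\<close> by linarith
      ultimately show False using odd' s by auto
    qed
    moreover have "even (s0 f j)" using entries0[OF f] ev by presburger
    moreover have "j = 0 \<or> j = 1 \<or> j = 2" using f by linarith
    ultimately have "\<bar>s0 f j\<bar> = 2" using ab s unfolding unit_pairs_def by auto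
    then show ?thesis using entries0[OF f] by linarith
  qed
  show False
  \<comment> \<open>The row index is l - m modulo 5, written in natural numbers.\<close>
  proof (rule masked_contradiction[where x = x and t = t and e = e and l = "(l + (5 - m mod 5)) mod 5"])
    show "corr x x p i + corr t t p i = delta 36 p i" if "p < 5" "i < 3" for p i
      unfolding x_def[abs_def] t_def[abs_def] corr_shift by (rule d_corr[OF that])
    show "corr x t p i = corr t x p i" if "p < 5" "i < 3" for p i
      unfolding x_def[abs_def] t_def[abs_def] corr_shift by (rule d_cross[OF that])
    show "e = 1 \<or> e = 2" by (rule mke(2))
    show "rows (\<lambda>f j. x f j mod 2) = parity_mask e" by (rule mask)
    show "\<bar>x f j\<bar> \<le> 2" for f j
    proof -
      have "(f + m) mod 5 < 5" "(j + k) mod 3 < 3" by simp_all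
      from entries0[OF this] show ?thesis unfolding x_def by linarith
    qed
    show "even (t f j) \<and> \<bar>t f j\<bar> \<le> 2" for f j
    proof -
      define F J where "F = (f + m) mod 5" and "J = (j + k) mod 3"
      have FJ: "F < 5" "J < 3" by (simp_all add: F_def J_def)
      have "unit_row s1 F" "eis_a s1 F = 0" "eis_b s1 F = 0" using l(4) z1 FJ by auto
      then have "s1 F 0 = s1 F 2" "s1 F 1 = s1 F 2" "s1 F 2 = 0 \<or> s1 F 2 = 2 \<or> s1 F 2 = -2"
        unfolding unit_row_def by linarith+
      moreover have "J = 0 \<or> J = 1 \<or> J = 2" using FJ by linarith
      ultimately have "even (s1 F J)" by auto
      then show ?thesis using entries1[OF FJ] unfolding t_def F_def[symmetric] J_def[symmetric] by presburger
    qed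
    show "x f j = 0" if f: "f < 5" "j < 3" "f \<noteq> 0" "even (x f j)" for f j
    proof -
      have two: "(\<Sum>j<3. x f j mod 2) = 2" using mask_sums(1)[OF mask f(1)] f(3) by simp
      have "\<exists>i<3. odd (x f i)"
      proof (rule ccontr)
        assume "\<not> (\<exists>i<3. odd (x f i))"
        then have "(\<Sum>j<3. x f j mod 2) = 0" by (intro sum.neutral) auto
        with two show False by simp
      qed
      then obtain i where "i < 3" "odd (x f i)" by blast
      then show ?thesis using zero_if_even[of "(f + m) mod 5" "(j + k) mod 3" "(i + k) mod 3"] f(4) unfolding x_def by simp
    qed
    show "(l + (5 - m mod 5)) mod 5 < 5" by simp
    have "l + (5 - m mod 5) + m = l + (5 - m mod 5) + m mod 5 + 5 * (m div 5)"
      using mult_div_mod_eq[of 5 m] by linarith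
    also have "\<dots> = l + 5 * (1 + m div 5)" using mod_less_divisor[of 5 m] by simp
    finally have "((l + (5 - m mod 5)) mod 5 + m) mod 5 = (l + 5 * (1 + m div 5)) mod 5"
      by (simp only: mod_add_left_eq)
    also have "\<dots> = l mod 5" by (rule mod_mult_self2)
    finally have "((l + (5 - m mod 5)) mod 5 + m) mod 5 = l mod 5" .
    then have "((l + (5 - m mod 5)) mod 5 + m) mod 5 = l" using l(1) by simp
    \<comment> \<open>In the exceptional row \<open>s0\<close> or \<open>s1\<close> has only entries
      2 or -2, and the entry bound makes the corresponding row of \<open>d0\<close> or
      \<open>d1\<close> zero.\<close>
    moreover have "(\<forall>j<3. d0 l j = 0) \<or> (\<forall>j<3. d1 l j = 0)"
    proof -
      have sp: "\<bar>s l j\<bar> = 2" if "unit_row s l" "\<bar>row_sum s l\<bar> = 6" "j < 3" for s j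
      proof -
        have "\<bar>s l 2\<bar> = 2" "s l 0 = s l 2" "s l 1 = s l 2" using that(1,2) unfolding unit_row_def by linarith+
        moreover have "j = 0 \<or> j = 1 \<or> j = 2" using that(3) by linarith
        ultimately show ?thesis by auto
      qed
      from l(3) show ?thesis
      proof
        assume "\<bar>row_sum s0 l\<bar> = 6 \<and> row_sum s1 l = 0"
        then have "d0 l j = 0" if "j < 3" for j using sp[of s0 j] l(4)[OF l(1)] entries0[OF l(1) that] that by auto
        then show ?thesis by blast
      next
        assume "row_sum s0 l = 0 \<and> \<bar>row_sum s1 l\<bar> = 6"
        then have "d1 l j = 0" if "j < 3" for j using sp[of s1 j] l(4)[OF l(1)] entries1[OF l(1) that] that by auto
        then show ?thesis by blast
      qed
    qed
    ultimately show "(\<forall>j<3. x ((l + (5 - m mod 5)) mod 5) j = 0) \<or> (\<forall>j<3. t ((l + (5 - m mod 5)) mod 5) j = 0)"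
      unfolding x_def t_def by (metis mod_less_divisor zero_less_numeral)
  qed
qed

end

lemma no_cw_arrays: "\<not> cw_arrays s0 s1 d0 d1"
proof
  assume A: "cw_arrays s0 s1 d0 d1"
  interpret cw_arrays s0 s1 d0 d1 by (rule A)
  \<comment> \<open>Exchanging the components reduces the second alternative of
    \<open>one_side_zero\<close> to the first.\<close>
  interpret sw: cw_arrays s1 s0 d1 d0 by (rule swap)
  show False using one_side_zero one_side_contradiction sw.one_side_contradiction by blast
qed

section \<open>From circulant weighing matrices to arrays\<close>

lemma circulant_row:
  assumes "circulant n W" "i < n" "j < n"
  shows "W i ((j + i) mod n) = W 0 j"
  using assms(2)
proof (induction i)
  case 0
  then show ?case using assms(3) by simp
next
  case (Suc i)
  have "(j + i) mod n < n" using assms(3) by simp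
  then have "W (i + 1) (((j + i) mod n + 1) mod n) = W i ((j + i) mod n)"
    using assms(1) Suc.prems unfolding circulant_def by simp
  then show ?case using Suc by (simp add: mod_simps)
qed

lemma circulant_autocorrelation:
  assumes "circulant n W" "weighing_matrix n w W" "m < n"
  shows "(\<Sum>j<n. W 0 j * W 0 ((j + m) mod n)) = (if m = 0 then int w else 0)"
proof -
  \<comment> \<open>Row -m modulo n is the first row translated by m, so orthogonality of rows
    becomes a statement on autocorrelation.\<close>
  define k where "k = (n - m) mod n"
  have k: "k < n" "k = 0 \<longleftrightarrow> m = 0" using assms(3) by (cases "m = 0"; simp add: k_def)+
  have "W k j = W 0 ((j + m) mod n)" if "j < n" for j
  proof -
    have "((j + m) mod n + k) mod n = (j + m + (n - m)) mod n" by (simp add: k_def mod_simps)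
    also have "\<dots> = j" using assms(3) that by simp
    finally show ?thesis using circulant_row[OF assms(1) k(1), of "(j + m) mod n"] that by simp
  qed
  then have "(\<Sum>j<n. W 0 j * W 0 ((j + m) mod n)) = (\<Sum>j<n. W 0 j * W k j)" by simp
  also have "\<dots> = (if 0 = k then int w else 0)"
  proof -
    have "0 < n" using assms(3) by simp
    with assms(2) k(1) show ?thesis unfolding weighing_matrix_def by blast
  qed
  finally show ?thesis using k(2) by auto
qed

text \<open>The coefficients 45, 36 and 40 are the idempotents of Z/60 that are 1 modulo 4, 5 and 3
  respectively and 0 modulo the other two.\<close>

definition crt :: "nat \<Rightarrow> nat \<Rightarrow> nat \<Rightarrow> nat" where
  "crt t f j = (45 * t + 36 * f + 40 * j) mod 60"

lemma sum_crt: "(\<Sum>t<4. \<Sum>f<5. \<Sum>j<3. g (crt t f j)) = (\<Sum>n<60. g n)" for g :: "nat \<Rightarrow> int"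
proof -
  let ?S = "{..<4} \<times> {..<5} \<times> {..<3 :: nat}" and ?c = "\<lambda>(t, f, j). crt t f j"
  have "set [0..<60] \<subseteq> set (map ?c (List.product [0..<4] (List.product [0..<5] [0..<3])))"
    unfolding crt_def by code_simp
  then have "{..<60} \<subseteq> ?c ` ?S" by (simp add: atLeast0LessThan)
  moreover have "?c ` ?S \<subseteq> {..<60}" by (auto simp: crt_def)
  ultimately have im: "?c ` ?S = {..<60}" by blast
  \<comment> \<open>A surjection between two sets of 60 elements is injective.\<close>
  then have "inj_on ?c ?S" by (intro eq_card_imp_inj_on) (simp_all add: card_cartesian_product)
  then have "(\<Sum>n<60. g n) = (\<Sum>z\<in>?S. g (?c z))"
    unfolding im[symmetric] by (simp add: sum.reindex)
  then show ?thesis by (simp add: sum.cartesian_product case_prod_unfold)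
qed

lemma crt_add: "(crt t f j + (45 * t' + 36 * f' + 40 * j')) mod 60 = crt ((t + t') mod 4) ((f + f') mod 5) ((j + j') mod 3)"
proof -
  have c: "(45 * ((t + t') mod 4)) mod 60 = (45 * (t + t')) mod 60"
    "(36 * ((f + f') mod 5)) mod 60 = (36 * (f + f')) mod 60" "(40 * ((j + j') mod 3)) mod 60 = (40 * (j + j')) mod 60"
    by (simp_all add: mult_mod_right mod_mod_cancel)
  have "(45 * t + 36 * f + 40 * j) + (45 * t' + 36 * f' + 40 * j') = 45 * (t + t') + 36 * (f + f') + 40 * (j + j')"
    by simp
  then show ?thesis
    unfolding crt_def mod_add_left_eq using mod_add_cong[OF mod_add_cong[OF c(1,2)] c(3)] by (simp only:)
qed

lemma crt_zero_iff:
  assumes "t < 4" "f < 5" "j < 3"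
  shows "(45 * t + 36 * f + 40 * j) mod 60 = (0::nat) \<longleftrightarrow> t = 0 \<and> f = 0 \<and> j = 0"
proof -
  have "\<forall>t\<in>set [0..<4]. \<forall>f\<in>set [0..<5]. \<forall>j\<in>set [0..<3]. \<not> (45 * t + 36 * f + 40 * j) mod 60 = (0::nat) \<or> t = 0 \<and> f = 0 \<and> j = 0"
    by code_simp
  moreover have "t \<in> set [0..<4]" "f \<in> set [0..<5]" "j \<in> set [0..<3]" using assms by simp_all
  ultimately have "\<not> (45 * t + 36 * f + 40 * j) mod 60 = (0::nat) \<or> t = 0 \<and> f = 0 \<and> j = 0" by blast
  then show ?thesis by auto
qed

lemma sum_less4: "(\<Sum>f<4. g f) = g 0 + g 1 + g 2 + g (3::nat)" for g :: "nat \<Rightarrow> 'a::comm_monoid_add"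
  by (simp add: numeral_eq_Suc add.assoc)

lemma cw_arrays_of_circulant:
  assumes "circulant 60 W" "weighing_matrix 60 36 W"
  obtains s0 s1 d0 d1 where "cw_arrays s0 s1 d0 d1"
proof -
  define A where "A t f j = W 0 (crt t f j)" for t f j
  define C where "C q p i = (\<Sum>t<4. corr (A t) (A ((t + q) mod 4)) p i)" for q p i
  have A: "A t f j \<in> {-1, 0, 1}" for t f j
    using assms(2) unfolding weighing_matrix_def A_def crt_def by simp
  have C: "C q p i = (if q = 0 \<and> p = 0 \<and> i = 0 then 36 else 0)" if "q < 4" "p < 5" "i < 3" for q p i
  proof -
    let ?m = "(45 * q + 36 * p + 40 * i) mod 60"
    have "C q p i = (\<Sum>t<4. \<Sum>f<5. \<Sum>j<3. (\<lambda>n. W 0 n * W 0 ((n + ?m) mod 60)) (crt t f j))"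
      unfolding C_def corr_def A_def by (simp add: crt_add[symmetric] mod_simps)
    also have "\<dots> = (\<Sum>n<60. W 0 n * W 0 ((n + ?m) mod 60))" by (rule sum_crt)
    also have "\<dots> = (if ?m = 0 then int 36 else 0)"
      by (rule circulant_autocorrelation[OF assms]) simp
    finally show ?thesis using crt_zero_iff[OF that] by auto
  qed
  have C': "corr (A 0) (A 0) p i + corr (A 1) (A 1) p i + corr (A 2) (A 2) p i + corr (A 3) (A 3) p i = delta 36 p i"
    "corr (A 0) (A 1) p i + corr (A 1) (A 2) p i + corr (A 2) (A 3) p i + corr (A 3) (A 0) p i = 0"
    "corr (A 0) (A 2) p i + corr (A 1) (A 3) p i + corr (A 2) (A 0) p i + corr (A 3) (A 1) p i = 0"
    "corr (A 0) (A 3) p i + corr (A 1) (A 0) p i + corr (A 2) (A 1) p i + corr (A 3) (A 2) p i = 0"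
    if "p < 5" "i < 3" for p i
    using C[of 0, OF _ that] C[of 1, OF _ that] C[of 2, OF _ that] C[of 3, OF _ that]
    by (simp_all add: C_def sum_less4 delta_def del: One_nat_def flip: numeral_2_eq_2)
  have "cw_arrays (\<lambda>f j. A 0 f j + A 2 f j) (\<lambda>f j. A 1 f j + A 3 f j) (\<lambda>f j. A 0 f j - A 2 f j) (\<lambda>f j. A 1 f j - A 3 f j)"
  proof
    fix p i :: nat assume pi: "p < 5" "i < 3"
    \<comment> \<open>The autocorrelations are the sum and difference of the equations for q = 0 and
      q = 2; the cross terms are those for q = 1 and q = 3.\<close>
    note c = C'[OF pi]
    show "corr (\<lambda>f j. A 0 f j + A 2 f j) (\<lambda>f j. A 0 f j + A 2 f j) p i + corr (\<lambda>f j. A 1 f j + A 3 f j) (\<lambda>f j. A 1 f j + A 3 f j) p i = delta 36 p i"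
      "corr (\<lambda>f j. A 0 f j + A 2 f j) (\<lambda>f j. A 1 f j + A 3 f j) p i + corr (\<lambda>f j. A 1 f j + A 3 f j) (\<lambda>f j. A 0 f j + A 2 f j) p i = 0"
      "corr (\<lambda>f j. A 0 f j - A 2 f j) (\<lambda>f j. A 0 f j - A 2 f j) p i + corr (\<lambda>f j. A 1 f j - A 3 f j) (\<lambda>f j. A 1 f j - A 3 f j) p i = delta 36 p i"
      "corr (\<lambda>f j. A 0 f j - A 2 f j) (\<lambda>f j. A 1 f j - A 3 f j) p i = corr (\<lambda>f j. A 1 f j - A 3 f j) (\<lambda>f j. A 0 f j - A 2 f j) p i"
      unfolding corr_bilinear using c by linarith+
  next
    fix f j :: nat
    show "even (A 0 f j + A 2 f j - (A 0 f j - A 2 f j)) \<and> \<bar>A 0 f j + A 2 f j\<bar> + \<bar>A 0 f j - A 2 f j\<bar> \<le> 2"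
      using A[of 0 f j] A[of 2 f j] by auto
    show "even (A 1 f j + A 3 f j - (A 1 f j - A 3 f j)) \<and> \<bar>A 1 f j + A 3 f j\<bar> + \<bar>A 1 f j - A 3 f j\<bar> \<le> 2"
      using A[of 1 f j] A[of 3 f j] by auto
  qed
  then show ?thesis by (rule that)
qed

theorem mainTheorem3:
  shows "\<not> (\<exists>W. circulant 60 W \<and> weighing_matrix 60 36 W)"
proof
  assume "\<exists>W. circulant 60 W \<and> weighing_matrix 60 36 W"
  then obtain W where "circulant 60 W" "weighing_matrix 60 36 W" by blast
  then obtain s0 s1 d0 d1 where "cw_arrays s0 s1 d0 d1" by (rule cw_arrays_of_circulant)
  with no_cw_arrays show False by blast
qed

end
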